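(* Let $\mathbf{Quant}$ be the symmetric monoidal category of finite-dimensional complex Hilbert spaces and completely positive maps, where each finite-dimensional Hilbert space $A$ is equipped with the completely mixed state $\mu_A\colon\mathbb C\to A$ whose density matrix is the identity, and let $F\colon\mathbf{FHilb}\to\mathbf{Quant}$ be the canonical functor. The symmetric monoidal subcategory $\mathcal P$ of pure morphisms of $\mathbf{Quant}$ consists of precisely those morphisms of the form $F(f)$ for $f$ a morphism of $\mathbf{FHilb}$.
   Context: $\mathbf{FHilb}$ is the category of finite-dimensional complex Hilbert spaces and linear maps. $\mathbf{Quant}$ has the same objects, and its morphisms $A\to B$ are completely positive maps from the algebra $L(A)$ of linear operators on $A$ to $L(B)$ (not required to preserve trace), with the usual tensor product and unit $\mathbb C$. The functor $F$ is the identity on objects and sends a linear map $f\colon A\to B$ to the completely positive map $\rho\mapsto f\rho f^\dagger$. The completely mixed state $\mu_A\colon\mathbb C\to A$ is the completely positive map sending $1$ to $\mathrm{id}_A$. Lifting: for morphisms $f\colon A\to B$ and $g\colon C\to D$ of a category, $f$ has the lifting property against $g$ when for all $u\colon A\to C$, $v\colon B\to D$ with $g\circ u=v\circ f$ there is $h\colon B\to C$ with $h\circ f=u$ and $g\circ h=v$. In a symmetric monoidal category, $f\oslash g$ means: for all objects $A',B'$, the morphism $f\otimes\mathrm{id}_{A'}$ has the lifting property against $g\otimes\mathrm{id}_{B'}$. Let $\mathcal M'$ be the collection of all completely mixed states $\mu_A$ ($A$ ranging over all finite-dimensional Hilbert spaces). The class of pure morphisms is $\mathcal P=\mathcal M'^{\oslash}=\{g\mid\forall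 f\in\mathcal M'\colon f\oslash g\}$.
   Formalization: The completely mixed state of the zero space is left out of the states defining pure morphisms, since with it the zero map on ℂ, which is F(0), would not be pure; finite-dimensional Hilbert spaces are taken to be the spaces ℂⁿ, up to unitary isomorphism. *)

theory Defs
  imports
    "HOL-Library.FuncSet"
    "Jordan_Normal_Form.Schur_Decomposition"
begin

section \<open>Lifting properties in symmetric monoidal categories\<close>

text \<open>
  Both categories below are presented on the objects \<open>\<complex>\<^sup>n\<close>, with the Kronecker
  product as tensor product. It is strictly associative and unital
  (\<open>(a * b) * c = a * (b * c)\<close> and \<open>1 * a = a = a * 1\<close> on objects), so the associators
  and unitors are identities and are not recorded.
\<close>

record ('o, 'm) smc =
  obj :: "'o set"
  arr :: "'m set"
  src :: "'m \<Rightarrow> 'o"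
  tgt :: "'m \<Rightarrow> 'o"
  ident :: "'o \<Rightarrow> 'm"
  comp :: "'m \<Rightarrow> 'm \<Rightarrow> 'm"  \<comment> \<open>\<open>comp C g f\<close> is \<open>g\<close> after \<open>f\<close>\<close>
  unit :: "'o"
  tensor_obj :: "'o \<Rightarrow> 'o \<Rightarrow> 'o"
  tensor :: "'m \<Rightarrow> 'm \<Rightarrow> 'm"
  braid :: "'o \<Rightarrow> 'o \<Rightarrow> 'm"

definition hom :: "('o, 'm) smc \<Rightarrow> 'o \<Rightarrow> 'o \<Rightarrow> 'm set" where
  "hom C a b = {f \<in> arr C. src C f = a \<and> tgt C f = b}"

definition lifts_against :: "('o, 'm) smc \<Rightarrow> 'm \<Rightarrow> 'm \<Rightarrow> bool" where
  "lifts_against C f g \<longleftrightarrow>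
    (\<forall>u \<in> hom C (src C f) (src C g). \<forall>v \<in> hom C (tgt C f) (tgt C g).
      comp C g u = comp C v f \<longrightarrow>
      (\<exists>h \<in> hom C (tgt C f) (src C g). comp C h f = u \<and> comp C g h = v))"

definition oslash :: "('o, 'm) smc \<Rightarrow> 'm \<Rightarrow> 'm \<Rightarrow> bool" where
  "oslash C f g \<longleftrightarrow>
    (\<forall>a' \<in> obj C. \<forall>b' \<in> obj C.
      lifts_against C (tensor C f (ident C a')) (tensor C g (ident C b')))"

definition right_oslash :: "('o, 'm) smc \<Rightarrow> 'm set \<Rightarrow> 'm set" where
  "right_oslash C M = {g \<in> arr C. \<forall>f \<in> M. oslash C f g}"

definition symmetric_monoidal_subcategory :: "('o, 'm) smc \<Rightarrow> 'm set \<Rightarrow> bool" where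
  "symmetric_monoidal_subcategory C S \<longleftrightarrow>
    S \<subseteq> arr C \<and>
    (\<forall>a \<in> obj C. ident C a \<in> S) \<and>
    (\<forall>f \<in> S. \<forall>g \<in> S. tgt C f = src C g \<longrightarrow> comp C g f \<in> S) \<and>
    (\<forall>f \<in> S. \<forall>g \<in> S. tensor C f g \<in> S) \<and>
    (\<forall>a \<in> obj C. \<forall>b \<in> obj C. braid C a b \<in> S)"


section \<open>Finite-dimensional Hilbert spaces and linear maps\<close>

text \<open>
  The basis vector \<open>e\<^sub>i \<otimes> e\<^sub>k\<close> of \<open>\<complex>\<^sup>a \<otimes> \<complex>\<^sup>b\<close> has index \<open>i * b + k\<close>.
\<close>

definition kron :: "complex mat \<Rightarrow> complex mat \<Rightarrow> complex mat" where
  "kron A B = mat (dim_row A * dim_row B) (dim_col A * dim_col B)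
    (\<lambda>(p, q). A $$ (p div dim_row B, q div dim_col B) * B $$ (p mod dim_row B, q mod dim_col B))"

text \<open>The map \<open>x \<otimes> y \<mapsto> y \<otimes> x\<close> from \<open>\<complex>\<^sup>a \<otimes> \<complex>\<^sup>b\<close> to \<open>\<complex>\<^sup>b \<otimes> \<complex>\<^sup>a\<close>.\<close>

definition swap_mat :: "nat \<Rightarrow> nat \<Rightarrow> complex mat" where
  "swap_mat a b = mat (b * a) (a * b)
    (\<lambda>(p, q). if p div a = q mod b \<and> p mod a = q div b then 1 else 0)"

definition FHilb :: "(nat, complex mat) smc" where
  "FHilb = \<lparr> obj = UNIV, arr = UNIV, src = dim_col, tgt = dim_row,
     ident = (\<lambda>a. 1\<^sub>m a), comp = (\<lambda>g f. g * f),
     unit = 1, tensor_obj = (\<lambda>a b. a * b), tensor = kron, braid = swap_mat \<rparr>"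


section \<open>Completely positive maps\<close>

text \<open>\<open>L(\<complex>\<^sup>n)\<close>, the algebra of linear operators on \<open>\<complex>\<^sup>n\<close>.\<close>

abbreviation ops :: "nat \<Rightarrow> complex mat set" where
  "ops n \<equiv> carrier_mat n n"

text \<open>In the order on \<open>complex\<close>, \<open>0 \<le> z\<close> means that \<open>z\<close> is real and nonnegative.\<close>

definition positive_op :: "nat \<Rightarrow> complex mat \<Rightarrow> bool" where
  "positive_op n X \<longleftrightarrow> X \<in> ops n \<and> (\<forall>v \<in> carrier_vec n. 0 \<le> (X *\<^sub>v v) \<bullet>c v)"

definition linear_on_ops :: "nat \<Rightarrow> nat \<Rightarrow> (complex mat \<Rightarrow> complex mat) \<Rightarrow> bool" where
  "linear_on_ops a b \<phi> \<longleftrightarrow>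
    (\<forall>X \<in> ops a. \<phi> X \<in> ops b) \<and>
    (\<forall>X \<in> ops a. \<forall>Y \<in> ops a. \<phi> (X + Y) = \<phi> X + \<phi> Y) \<and>
    (\<forall>c. \<forall>X \<in> ops a. \<phi> (c \<cdot>\<^sub>m X) = c \<cdot>\<^sub>m \<phi> X)"

definition matrix_unit :: "nat \<Rightarrow> nat \<Rightarrow> nat \<Rightarrow> complex mat" where
  "matrix_unit n i j = mat n n (\<lambda>(p, q). if p = i \<and> q = j then 1 else 0)"

text \<open>
  For \<open>\<phi> : L(\<complex>\<^sup>a) \<rightarrow> L(\<complex>\<^sup>b)\<close> and \<open>\<psi> : L(\<complex>\<^sup>a\<^sup>') \<rightarrow> L(\<complex>\<^sup>b\<^sup>')\<close>, the linear map
  \<open>\<phi> \<otimes> \<psi>\<close> is given by expanding its argument in the basis of all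
  \<open>kron (matrix_unit a i j) (matrix_unit a' k l)\<close>; see \<open>tensor_map_kron\<close> below.
\<close>

definition tensor_map :: "nat \<Rightarrow> nat \<Rightarrow> nat \<Rightarrow> nat \<Rightarrow>
    (complex mat \<Rightarrow> complex mat) \<Rightarrow> (complex mat \<Rightarrow> complex mat) \<Rightarrow> complex mat \<Rightarrow> complex mat" where
  "tensor_map a b a' b' \<phi> \<psi> X = mat (b * b') (b * b')
    (\<lambda>(p, q). \<Sum>i<a. \<Sum>j<a. \<Sum>k<a'. \<Sum>l<a'.
      X $$ (i * a' + k, j * a' + l) *
      kron (\<phi> (matrix_unit a i j)) (\<psi> (matrix_unit a' k l)) $$ (p, q))"

text \<open>\<open>tensor_map\<close> is the tensor product of linear maps: it sends \<open>X \<otimes> Y\<close> to \<open>\<phi> X \<otimes> \<psi> Y\<close>.\<close>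

lemma linear_on_ops_expand:
  assumes lin: "linear_on_ops a b \<phi>" and X: "X \<in> ops a" and p: "p < b" and q: "q < b"
  shows "\<phi> X $$ (p, q) = (\<Sum>i<a. \<Sum>j<a. X $$ (i, j) * \<phi> (matrix_unit a i j) $$ (p, q))"
proof -
  have add: "\<phi> (Y + Z) = \<phi> Y + \<phi> Z" if "Y \<in> ops a" "Z \<in> ops a" for Y Z
    using lin that by (auto simp: linear_on_ops_def)
  have smult: "\<phi> (c \<cdot>\<^sub>m Y) = c \<cdot>\<^sub>m \<phi> Y" if "Y \<in> ops a" for c Y
    using lin that by (auto simp: linear_on_ops_def)
  have ops: "\<phi> Y \<in> ops b" if "Y \<in> ops a" for Y
    using lin that by (auto simp: linear_on_ops_def)
  define M where "M S = mat a a (\<lambda>ij. if ij \<in> S then X $$ ij else 0)" for S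
  have M: "M S \<in> ops a" for S
    by (simp add: M_def)
  have E: "matrix_unit a i j \<in> ops a" for i j
    by (simp add: matrix_unit_def)
  have "\<phi> (M S) $$ (p, q) = (\<Sum>ij\<in>S. X $$ ij * \<phi> (matrix_unit a (fst ij) (snd ij)) $$ (p, q))"
    if "finite S" "S \<subseteq> {..<a} \<times> {..<a}" for S
    using that
  proof (induction S rule: finite_induct)
    case empty
    have "M {} = 0 \<cdot>\<^sub>m M {}"
      by (rule eq_matI) (auto simp: M_def)
    then have "\<phi> (M {}) = 0 \<cdot>\<^sub>m \<phi> (M {})"
      using smult[OF M] by metis
    then have "\<phi> (M {}) $$ (p, q) = (0 \<cdot>\<^sub>m \<phi> (M {})) $$ (p, q)"
      by simp
    also have "\<dots> = 0"
      using carrier_matD[OF ops[OF M]] p q by simp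
    finally show ?case
      by simp
  next
    case (insert ij S)
    obtain i j where ij: "ij = (i, j)" "i < a" "j < a"
      using insert.prems by auto
    have "M (insert ij S) = M S + X $$ ij \<cdot>\<^sub>m matrix_unit a i j"
      using insert.hyps ij by (intro eq_matI) (auto simp: M_def matrix_unit_def)
    then have "\<phi> (M (insert ij S)) = \<phi> (M S) + X $$ ij \<cdot>\<^sub>m \<phi> (matrix_unit a i j)"
      using add[OF M] smult[OF E] E by simp
    then have "\<phi> (M (insert ij S)) $$ (p, q)
        = \<phi> (M S) $$ (p, q) + X $$ ij * \<phi> (matrix_unit a i j) $$ (p, q)"
      using carrier_matD[OF ops[OF M]] carrier_matD[OF ops[OF E]] p q by simp
    then show ?case
      using insert ij by simp
  qed
  from this[of "{..<a} \<times> {..<a}"] have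
    "\<phi> (M ({..<a} \<times> {..<a})) $$ (p, q)
      = (\<Sum>i<a. \<Sum>j<a. X $$ (i, j) * \<phi> (matrix_unit a i j) $$ (p, q))"
    by (simp add: sum.cartesian_product case_prod_beta)
  moreover have "M ({..<a} \<times> {..<a}) = X"
    using X by (intro eq_matI) (auto simp: M_def)
  ultimately show ?thesis
    by simp
qed

lemma tensor_map_kron:
  assumes \<phi>: "linear_on_ops a b \<phi>" and \<psi>: "linear_on_ops a' b' \<psi>"
    and X: "X \<in> ops a" and Y: "Y \<in> ops a'"
  shows "tensor_map a b a' b' \<phi> \<psi> (kron X Y) = kron (\<phi> X) (\<psi> Y)"
proof -
  have dims: "dim_row (\<phi> Z) = b" "dim_col (\<phi> Z) = b" if "Z \<in> ops a" for Z
    using \<phi> that by (auto simp: linear_on_ops_def)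
  have dims': "dim_row (\<psi> Z) = b'" "dim_col (\<psi> Z) = b'" if "Z \<in> ops a'" for Z
    using \<psi> that by (auto simp: linear_on_ops_def)
  have E: "matrix_unit n i j \<in> ops n" for n i j
    by (simp add: matrix_unit_def)
  have idx: "i * a' + k < a * a'" if "i < a" "k < a'" for i k
    using that mult_le_mono1[of "Suc i" a a'] by simp
  have XY: "kron X Y $$ (i * a' + k, j * a' + l) = X $$ (i, j) * Y $$ (k, l)"
    if "i < a" "j < a" "k < a'" "l < a'" for i j k l
    using that X Y idx by (simp add: kron_def carrier_matD)
  show ?thesis
  proof (rule eq_matI)
    fix p q
    assume "p < dim_row (kron (\<phi> X) (\<psi> Y))" "q < dim_col (kron (\<phi> X) (\<psi> Y))"
    then have pq: "p < b * b'" "q < b * b'"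
      using dims[OF X] dims'[OF Y] by (auto simp: kron_def)
    then have b': "b' > 0"
      by (cases b') auto
    have lt: "p div b' < b" "q div b' < b" "p mod b' < b'" "q mod b' < b'"
      using pq b' by (auto simp: less_mult_imp_div_less)
    have "tensor_map a b a' b' \<phi> \<psi> (kron X Y) $$ (p, q)
      = (\<Sum>i<a. \<Sum>j<a. \<Sum>k<a'. \<Sum>l<a'. (X $$ (i, j) * Y $$ (k, l)) *
          (\<phi> (matrix_unit a i j) $$ (p div b', q div b') *
           \<psi> (matrix_unit a' k l) $$ (p mod b', q mod b')))"
      using pq by (simp add: tensor_map_def XY) (simp add: kron_def dims[OF E] dims'[OF E])
    also have "\<dots> = (\<Sum>i<a. \<Sum>j<a. X $$ (i, j) * \<phi> (matrix_unit a i j) $$ (p div b', q div b')) *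
      (\<Sum>k<a'. \<Sum>l<a'. Y $$ (k, l) * \<psi> (matrix_unit a' k l) $$ (p mod b', q mod b'))"
      by (simp only: sum_distrib_right) (simp only: sum_distrib_left, simp add: mult_ac)
    also have "\<dots> = kron (\<phi> X) (\<psi> Y) $$ (p, q)"
      using pq lt dims[OF X] dims'[OF Y]
      by (simp add: kron_def linear_on_ops_expand[OF \<phi> X] linear_on_ops_expand[OF \<psi> Y])
    finally show "tensor_map a b a' b' \<phi> \<psi> (kron X Y) $$ (p, q) = kron (\<phi> X) (\<psi> Y) $$ (p, q)" .
  qed (use dims[OF X] dims'[OF Y] in \<open>auto simp: tensor_map_def kron_def\<close>)
qed

definition completely_positive :: "nat \<Rightarrow> nat \<Rightarrow> (complex mat \<Rightarrow> complex mat) \<Rightarrow> bool" where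
  "completely_positive a b \<phi> \<longleftrightarrow> linear_on_ops a b \<phi> \<and>
    (\<forall>k X. positive_op (a * k) X \<longrightarrow> positive_op (b * k) (tensor_map a b k k \<phi> (\<lambda>Y. Y) X))"

text \<open>
  The map of an arrow is made extensional (\<open>undefined\<close> outside \<open>L(\<complex>\<^sup>a)\<close>), so that
  equality of arrows is equality of morphisms.
\<close>

datatype qarrow = QArrow (qsrc: nat) (qtgt: nat) (qmap: "complex mat \<Rightarrow> complex mat")

definition Quant :: "(nat, qarrow) smc" where
  "Quant = \<lparr> obj = UNIV,
     arr = {QArrow a b \<phi> | a b \<phi>. \<phi> \<in> extensional (ops a) \<and> completely_positive a b \<phi>},
     src = qsrc, tgt = qtgt,
     ident = (\<lambda>a. QArrow a a (restrict (\<lambda>X. X) (ops a))),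
     comp = (\<lambda>g f. QArrow (qsrc f) (qtgt g) (compose (ops (qsrc f)) (qmap g) (qmap f))),
     unit = 1,
     tensor_obj = (\<lambda>a b. a * b),
     tensor = (\<lambda>f g. QArrow (qsrc f * qsrc g) (qtgt f * qtgt g)
       (restrict (tensor_map (qsrc f) (qtgt f) (qsrc g) (qtgt g) (qmap f) (qmap g))
         (ops (qsrc f * qsrc g)))),
     braid = (\<lambda>a b. QArrow (a * b) (b * a)
       (restrict (\<lambda>X. swap_mat a b * X * mat_adjoint (swap_mat a b)) (ops (a * b)))) \<rparr>"

text \<open>The functor \<open>F\<close> from \<open>FHilb\<close> to \<open>Quant\<close>, on morphisms; on objects it is the identity.\<close>

definition quantize :: "complex mat \<Rightarrow> qarrow" where
  "quantize f = QArrow (dim_col f) (dim_row f)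
    (restrict (\<lambda>\<rho>. f * \<rho> * mat_adjoint f) (ops (dim_col f)))"

definition mixed_state :: "nat \<Rightarrow> qarrow" where
  "mixed_state a = QArrow 1 a (restrict (\<lambda>X. X $$ (0, 0) \<cdot>\<^sub>m 1\<^sub>m a) (ops 1))"

text \<open>
  The zero space is an object, but it has no states, and \<open>mixed_state 0\<close> is the zero map into
  it. Lifting against \<open>mixed_state 0\<close> is a nondegeneracy condition that morphisms such as
  \<open>quantize 0\<close> violate (lemma \<open>not_oslash_mixed_state_0\<close> below), so only the completely mixed
  states of nonzero spaces are used.
\<close>

definition mixed_states :: "qarrow set" where
  "mixed_states = {mixed_state a | a. a \<noteq> 0}"

lemma not_oslash_mixed_state_0: "\<not> oslash Quant (mixed_state 0) (quantize (0\<^sub>m 1 1))"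
proof
  let ?I = "ident Quant 1"
  let ?f = "tensor Quant (mixed_state 0) ?I"
  let ?g = "tensor Quant (quantize (0\<^sub>m 1 1)) ?I"
  let ?v = "QArrow 0 1 (restrict (\<lambda>X. 0\<^sub>m 1 1) (ops 0))"
  assume "oslash Quant (mixed_state 0) (quantize (0\<^sub>m 1 1))"
  moreover have "1 \<in> obj Quant"
    by (simp add: Quant_def)
  ultimately have lift: "lifts_against Quant ?f ?g"
    unfolding oslash_def by blast
  have st: "src Quant = qsrc" "tgt Quant = qtgt"
    by (simp_all add: Quant_def)
  have f: "qsrc ?f = 1" "qtgt ?f = 0"
    by (simp_all add: Quant_def mixed_state_def)
  have g: "qsrc ?g = 1" "qtgt ?g = 1"
    by (simp_all add: Quant_def quantize_def)
  have fX: "qmap ?f X \<in> ops 0" if "X \<in> ops 1" for X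
    using that by (simp add: Quant_def mixed_state_def tensor_map_def)
  have gX: "qmap ?g X = 0\<^sub>m 1 1" if X: "X \<in> ops 1" for X
    using X by (auto simp: Quant_def quantize_def tensor_map_def kron_def matrix_unit_def
        mat_adjoint_def intro!: eq_matI)
  have vX: "qmap ?v X = 0\<^sub>m 1 1" if "X \<in> ops 0" for X
    using that by simp
  have "tensor_map 1 1 k k (restrict (\<lambda>X. X) (ops 1)) (\<lambda>Y. Y) X = X" if "X \<in> ops k" for k X
  proof (rule eq_matI)
    fix p q assume "p < dim_row X" "q < dim_col X"
    then have pq: "p < k" "q < k"
      using that by auto
    have "(\<Sum>l<k. \<Sum>m<k. X $$ (l, m) * (if p = l \<and> q = m then 1 else 0))
        = (\<Sum>l<k. \<Sum>m<k. if q = m then if p = l then X $$ (l, m) else 0 else 0)"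
      by (intro sum.cong refl) simp
    also have "\<dots> = X $$ (p, q)"
      using pq by simp
    finally show "tensor_map 1 1 k k (restrict (\<lambda>X. X) (ops 1)) (\<lambda>Y. Y) X $$ (p, q) = X $$ (p, q)"
      using pq that by (simp add: tensor_map_def kron_def matrix_unit_def)
  qed (use that in \<open>auto simp: tensor_map_def\<close>)
  then have "completely_positive 1 1 (restrict (\<lambda>X. X) (ops 1))"
    by (auto simp: completely_positive_def linear_on_ops_def positive_op_def)
  then have u: "?I \<in> hom Quant (qsrc ?f) (qsrc ?g)"
    unfolding f g by (simp add: hom_def Quant_def)
  have "tensor_map 0 1 k k (restrict (\<lambda>X. 0\<^sub>m 1 1) (ops 0)) (\<lambda>Y. Y) X = 0\<^sub>m k k" for k X
    by (rule eq_matI) (auto simp: tensor_map_def)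
  moreover have "positive_op k (0\<^sub>m k k)" for k
    by (auto simp: positive_op_def scalar_prod_def intro!: sum_nonneg)
  ultimately have "completely_positive 0 1 (restrict (\<lambda>X. 0\<^sub>m 1 1) (ops 0))"
    by (auto simp: completely_positive_def linear_on_ops_def)
  then have v: "?v \<in> hom Quant (qtgt ?f) (qtgt ?g)"
    unfolding f g by (simp add: hom_def Quant_def)
  have comp: "comp Quant y x = QArrow (qsrc x) (qtgt y) (compose (ops (qsrc x)) (qmap y) (qmap x))"
    for x y by (simp add: Quant_def)
  have I: "qsrc ?I = 1" "qtgt ?I = 1" "\<And>X. X \<in> ops 1 \<Longrightarrow> qmap ?I X = X"
    by (simp_all add: Quant_def)
  have "compose (ops 1) (qmap ?g) (qmap ?I) = compose (ops 1) (qmap ?v) (qmap ?f)"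
    by (rule ext) (simp add: compose_def I(3) gX fX vX del: One_nat_def qarrow.sel)
  then have "comp Quant ?g ?I = comp Quant ?v ?f"
    by (simp add: comp f g I del: One_nat_def)
  then obtain h where hf: "comp Quant h ?f = ?I"
    using lift u v unfolding lifts_against_def st by blast
  have h: "qmap h (qmap ?f X) = X" if "X \<in> ops 1" for X
  proof -
    have "qmap (comp Quant h ?f) X = X"
      unfolding hf by (rule I(3)[OF that])
    then show ?thesis
      unfolding comp qarrow.sel f compose_eq[OF that] .
  qed
  have "qmap ?f (1\<^sub>m 1) = qmap ?f (0\<^sub>m 1 1)"
    using fX[of "1\<^sub>m 1"] fX[of "0\<^sub>m 1 1"] by (intro eq_matI) auto
  then have "(1\<^sub>m 1 :: complex mat) = 0\<^sub>m 1 1"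
    using h[of "1\<^sub>m 1"] h[of "0\<^sub>m 1 1"] by simp
  then have "(1\<^sub>m 1 :: complex mat) $$ (0, 0) = 0\<^sub>m 1 1 $$ (0, 0)"
    by (rule arg_cong)
  then show False
    by simp
qed

definition pure_morphisms :: "qarrow set" where
  "pure_morphisms = right_oslash Quant mixed_states"

end

theory Submission
  imports Defs
begin

text \<open>
  A lifting problem for \<open>\<mu>\<^sub>a \<otimes> id\<close> against \<open>F(M)\<close> consists of completely positive maps \<open>u\<close>, \<open>v\<close>
  for which \<open>F(M) \<circ> u\<close> is the partial trace of \<open>v\<close> over \<open>\<complex>\<^sup>a\<close>. If \<open>U\<^sub>t\<close> and \<open>V\<^sub>s\<close> are Kraus operators
  of \<open>u\<close> and \<open>v\<close>, and \<open>V\<^sub>s\<close> has the blocks \<open>V\<^sub>s\<^sub>,\<^sub>i\<close> (\<open>i < a\<close>), then \<open>M U\<^sub>t\<close> and \<open>V\<^sub>s\<^sub>,\<^sub>i\<close> are two Kraus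
  families of the same map. Hence they are related by a coisometry, and the same coisometry applied
  to \<open>U\<^sub>t\<close> gives the Kraus operators of a filler. The part of it that \<open>M U\<^sub>t\<close> does not see is
  put into block \<open>0\<close>, which exists because \<open>a \<noteq> 0\<close>.

  Conversely, if \<open>g\<close> with Kraus operators \<open>G\<^sub>s\<close> (\<open>s < n\<close>) lifts against \<open>\<mu>\<^sub>n\<close>, consider the square
  formed by the maximally entangled state and the map sending \<open>e\<^sub>s e\<^sub>s\<^sup>*\<close> to the pure state with
  vector \<open>G\<^sub>s\<close>. A filler sends each \<open>e\<^sub>s e\<^sub>s\<^sup>*\<close> to something dominated by the maximally entangled state,
  hence to a multiple of it, so \<open>g\<close> is proportional to \<open>F(G\<^sub>s)\<close> for every \<open>s\<close> with \<open>G\<^sub>s \<noteq> 0\<close>.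
\<close>


section \<open>Positive semidefinite kernels\<close>

text \<open>Kernels on an arbitrary index type rather than matrices: an index can be split off in an
  induction, and pairs can serve as indices. Comparison with 0 also forces the form to be
  real.\<close>

definition psd :: "'i set \<Rightarrow> ('i \<Rightarrow> 'i \<Rightarrow> complex) \<Rightarrow> bool" where
  "psd I K \<longleftrightarrow> (\<forall>v. 0 \<le> (\<Sum>p\<in>I. \<Sum>q\<in>I. cnj (v p) * K p q * v q))"

lemma psd_subset:
  assumes "psd I K" "J \<subseteq> I" "finite I"
  shows "psd J K"
  unfolding psd_def
proof
  fix v :: "_ \<Rightarrow> complex"
  define w where "w = (\<lambda>p. if p \<in> J then v p else 0)"
  have "(\<Sum>p\<in>I. \<Sum>q\<in>I. cnj (w p) * K p q * w q) = (\<Sum>p\<in>J. \<Sum>q\<in>I. cnj (w p) * K p q * w q)"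
    using assms by (intro sum.mono_neutral_right) (auto simp: w_def)
  also have "\<dots> = (\<Sum>p\<in>J. \<Sum>q\<in>J. cnj (w p) * K p q * w q)"
    using assms by (intro sum.cong refl sum.mono_neutral_right) (auto simp: w_def)
  also have "\<dots> = (\<Sum>p\<in>J. \<Sum>q\<in>J. cnj (v p) * K p q * v q)"
    by (intro sum.cong) (auto simp: w_def)
  finally show "0 \<le> (\<Sum>p\<in>J. \<Sum>q\<in>J. cnj (v p) * K p q * v q)"
    using assms(1)[unfolded psd_def, rule_format, of w] by (simp only:)
qed

lemma psd_diag:
  assumes "psd I K" "finite I" "p \<in> I"
  shows "0 \<le> K p p"
proof -
  have "psd {p} K"
    using psd_subset[OF assms(1) _ assms(2)] assms(3) by auto
  from this[unfolded psd_def, rule_format, of "\<lambda>_. 1"] show ?thesis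
    by simp
qed

lemma psd_pair:
  assumes "psd I K" "finite I" "p \<in> I" "q \<in> I" "p \<noteq> q"
  shows "0 \<le> K p p + z * K p q + cnj z * K q p + cnj z * z * K q q"
proof -
  have "psd {p, q} K"
    using psd_subset[OF assms(1) _ assms(2)] assms(3,4) by auto
  from this[unfolded psd_def, rule_format, of "(\<lambda>_. z)(p := 1)"] show ?thesis
    using assms(5) by (simp add: algebra_simps)
qed

text \<open>The form is real at every vector. Testing \<open>(1, z)\<close> with
  \<open>z = 1\<close> makes the imaginary parts of the two off-diagonal entries opposite, and
  \<open>z = \<i>\<close> makes the real parts equal.\<close>

lemma psd_hermitian:
  assumes "psd I K" "finite I" "p \<in> I" "q \<in> I"
  shows "K q p = cnj (K p q)"
proof (cases "p = q")
  case True
  then show ?thesis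
    using psd_diag[OF assms(1-3)] by (auto simp: complex_eq_iff less_eq_complex_def)
next
  case False
  have "Im (K p p) = 0" "Im (K q q) = 0"
    using psd_diag[OF assms(1,2)] assms(3,4) by (auto simp: less_eq_complex_def)
  then show ?thesis
    using psd_pair[OF assms False, of 1] psd_pair[OF assms False, of \<i>]
    by (auto simp: complex_eq_iff less_eq_complex_def)
qed

text \<open>With \<open>K q q = 0\<close> the form at \<open>(1, z)\<close> is real-affine in
  \<open>z\<close>, so a nonzero \<open>K p q\<close> would make it negative somewhere.\<close>

lemma psd_zero_diag:
  assumes "psd I K" "finite I" "p \<in> I" "q \<in> I" "K q q = 0"
  shows "K p q = 0"
proof (cases "p = q")
  case False
  define s where "s = Re (K p p) + 1"
  have "0 \<le> s - 1"
    using psd_diag[OF assms(1-3)] by (simp add: s_def less_eq_complex_def)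
  have eq: "K p p + z * K p q + cnj z * K q p + cnj z * z * K q q
      = K p p + z * K p q + cnj (z * K p q)" for z
    using psd_hermitian[OF assms(1-4)] assms(5) by simp
  show ?thesis
  proof (rule ccontr)
    assume nz: "K p q \<noteq> 0"
    \<comment> \<open>Here \<open>z * K p q = - s\<close>, so the form has real part
      \<open>(s - 1) - 2 * s < 0\<close>.\<close>
    from psd_pair[OF assms(1-4) False, of "- of_real s / K p q"]
    show False
      unfolding eq using nz \<open>0 \<le> s - 1\<close> by (simp add: less_eq_complex_def s_def)
  qed
qed (use assms in simp)

text \<open>Cholesky factorization. The coefficients \<open>c\<close> express that the columns of \<open>T\<close> lie in the
  range of \<open>K\<close>; hence \<open>\<Sum>\<^sub>t c\<^sub>t c\<^sub>t\<^sup>*\<close> is a generalized inverse of \<open>K\<close>.\<close>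

lemma psd_factorization:
  assumes "finite I" "psd I K"
  shows "\<exists>(r::nat) T c. (\<forall>t<r. \<forall>p\<in>I. T t p = (\<Sum>q\<in>I. K p q * c t q)) \<and>
    (\<forall>p\<in>I. \<forall>q\<in>I. K p q = (\<Sum>t<r. T t p * cnj (T t q)))"
  using assms
proof (induction I arbitrary: K rule: finite_induct)
  case empty
  then show ?case by simp
next
  case (insert x I)
  have herm: "K q p = cnj (K p q)" if "p \<in> insert x I" "q \<in> insert x I" for p q
    using psd_hermitian[OF insert.prems _ that] insert.hyps by simp
  have xx: "0 \<le> K x x"
    using psd_diag[OF insert.prems] insert.hyps by simp
  show ?case
  proof (cases "K x x = 0")
    \<comment> \<open>Zero pivot: row and column \<open>x\<close> vanish, and the factorization on
      \<open>I\<close> is extended by 0.\<close>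
    case True
    then have z: "K p x = 0" "K x p = 0" if "p \<in> I" for p
      using psd_zero_diag[OF insert.prems _ _ _ True, of p] herm[of x p] that insert.hyps by auto
    have "psd I K"
      using psd_subset[OF insert.prems] insert.hyps by auto
    from insert.IH[OF this] obtain r :: nat and T c where
      T: "\<And>t p. t < r \<Longrightarrow> p \<in> I \<Longrightarrow> T t p = (\<Sum>q\<in>I. K p q * c t q)" and
      K: "\<And>p q. p \<in> I \<Longrightarrow> q \<in> I \<Longrightarrow> K p q = (\<Sum>t<r. T t p * cnj (T t q))"
      by blast
    have ne: "\<And>p. p \<in> I \<Longrightarrow> p \<noteq> x" using insert.hyps by auto
    show ?thesis
      by (rule exI[of _ r], rule exI[of _ "\<lambda>t. (T t)(x := 0)"], rule exI[of _ "\<lambda>t. (c t)(x := 0)"])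
        (use insert.hyps True z ne in \<open>auto simp: T K[symmetric] cong: sum.cong\<close>)
  next
    case False
    define d where "d = Re (K x x)"
    have Kxx: "K x x = of_real d" and d: "d > 0"
      using xx False by (auto simp: d_def complex_eq_iff less_eq_complex_def)
    \<comment> \<open>The Schur complement of the pivot \<open>K x x\<close>.\<close>
    define K' where "K' p q = K p q - K p x * K x q / of_real d" for p q
    have "psd I K'"
      unfolding psd_def
    proof
      fix v
      define s where "s = (\<Sum>q\<in>I. K x q * v q)"
      \<comment> \<open>This entry at \<open>x\<close> completes the square: the form of
        \<open>K\<close> at \<open>w\<close> equals the form of \<open>K'\<close> at
        \<open>v\<close>.\<close>
      define w where "w = v(x := - s / of_real d)"
      have s': "(\<Sum>p\<in>I. cnj (v p) * K p x) = cnj s"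
        unfolding s_def cnj_sum by (intro sum.cong refl) (simp add: herm[of x, symmetric] mult.commute)
      have w: "w p = v p" if "p \<in> I" for p using that insert.hyps by (auto simp: w_def)
      have wx: "w x = - s / of_real d" by (simp add: w_def)
      have "(\<Sum>p\<in>insert x I. \<Sum>q\<in>insert x I. cnj (w p) * K p q * w q)
        = cnj (w x) * K x x * w x + cnj (w x) * (\<Sum>q\<in>I. K x q * v q)
          + (\<Sum>p\<in>I. cnj (v p) * K p x) * w x + (\<Sum>p\<in>I. \<Sum>q\<in>I. cnj (v p) * K p q * v q)"
        using insert.hyps
        by (simp add: w sum.distrib sum_distrib_left sum_distrib_right algebra_simps cong: sum.cong)
      also have "\<dots> = (\<Sum>p\<in>I. \<Sum>q\<in>I. cnj (v p) * K p q * v q) - cnj s * s / of_real d"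
        unfolding s' s_def[symmetric] wx Kxx using d by (simp add: field_simps)
      also have "cnj s * s / of_real d = (\<Sum>p\<in>I. \<Sum>q\<in>I. cnj (v p) * (K p x * K x q / of_real d) * v q)"
        unfolding s'[symmetric] unfolding s_def sum_product sum_divide_distrib
        by (intro sum.cong refl) (simp add: algebra_simps)
      also have "(\<Sum>p\<in>I. \<Sum>q\<in>I. cnj (v p) * K p q * v q) - \<dots>
          = (\<Sum>p\<in>I. \<Sum>q\<in>I. cnj (v p) * K' p q * v q)"
        by (simp add: K'_def algebra_simps sum_subtractf)
      finally show "0 \<le> (\<Sum>p\<in>I. \<Sum>q\<in>I. cnj (v p) * K' p q * v q)"
        using insert.prems[unfolded psd_def, rule_format, of w] by (simp only:)
    qed
    from insert.IH[OF this] obtain r :: nat and T c where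
      T: "\<And>t p. t < r \<Longrightarrow> p \<in> I \<Longrightarrow> T t p = (\<Sum>q\<in>I. K' p q * c t q)" and
      K: "\<And>p q. p \<in> I \<Longrightarrow> q \<in> I \<Longrightarrow> K' p q = (\<Sum>t<r. T t p * cnj (T t q))"
      by blast
    define T' where "T' t = (if t < r then (T t)(x := 0) else (\<lambda>p. K p x / of_real (sqrt d)))" for t
    \<comment> \<open>For \<open>t < r\<close> the entry at \<open>x\<close> is chosen so that
      \<open>K c' = K' c\<close>. The last vector is a multiple of the unit vector at
      \<open>x\<close> and produces the new column \<open>K p x / sqrt d\<close>.\<close>
    define c' where "c' t = (if t < r then (c t)(x := - (\<Sum>q\<in>I. K x q * c t q) / of_real d)
      else (\<lambda>q. if q = x then 1 / of_real (sqrt d) else 0))" for t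
    have ne: "p \<noteq> x" if "p \<in> I" for p using insert.hyps that by auto
    have sq: "complex_of_real (sqrt d) * of_real (sqrt d) = of_real d"
      using d unfolding of_real_mult[symmetric] by simp
    have "T' t p = (\<Sum>q\<in>insert x I. K p q * c' t q)" if "t < Suc r" "p \<in> insert x I" for t p
    proof (cases "t < r")
      case True
      have "(\<Sum>q\<in>insert x I. K p q * c' t q)
          = (\<Sum>q\<in>I. K p q * c t q) - K p x * (\<Sum>q\<in>I. K x q * c t q) / of_real d"
        using insert.hyps True ne by (simp add: c'_def cong: sum.cong)
      also have "\<dots> = (\<Sum>q\<in>I. K' p q * c t q)"
        by (simp add: K'_def algebra_simps sum_subtractf sum_distrib_left sum_divide_distrib)
      also have "\<dots> = T' t p"
      proof (cases "p = x")
        case True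
        then have "K' p q = 0" for q using d by (simp add: K'_def Kxx)
        then show ?thesis using True \<open>t < r\<close> by (simp add: T'_def)
      next
        case False
        then show ?thesis using that \<open>t < r\<close> by (simp add: T'_def T)
      qed
      finally show ?thesis ..
    next
      case False
      then show ?thesis
        using insert.hyps ne by (simp add: T'_def c'_def cong: sum.cong)
    qed
    moreover have "K p q = (\<Sum>t<Suc r. T' t p * cnj (T' t q))"
      if pq: "p \<in> insert x I" "q \<in> insert x I" for p q
    proof -
      have "(\<Sum>t<Suc r. T' t p * cnj (T' t q))
          = (\<Sum>t<r. T' t p * cnj (T' t q)) + K p x * K x q / of_real d"
        using herm[OF pq(2), of x] d sq by (simp add: T'_def field_simps)
      also have "(\<Sum>t<r. T' t p * cnj (T' t q)) = K' p q"
      proof (cases "p = x \<or> q = x")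
        case True
        then have "K' p q = 0" using d by (auto simp: K'_def Kxx)
        then show ?thesis using True by (auto simp: T'_def)
      next
        case False
        then show ?thesis using pq by (simp add: K T'_def)
      qed
      finally show ?thesis by (simp add: K'_def)
    qed
    ultimately show ?thesis by blast
  qed
qed

section \<open>Families with a common Gram matrix\<close>

lemma sum_mult_cnj_self_eq_0:
  assumes "finite S" "(\<Sum>s\<in>S. z s * cnj (z s)) = 0" "s \<in> S"
  shows "z s = 0"
proof -
  have "of_real (\<Sum>s\<in>S. (cmod (z s))\<^sup>2) = (0 :: complex)"
    using assms(2) by (simp add: complex_norm_square del: of_real_power)
  then have "(\<Sum>s\<in>S. (cmod (z s))\<^sup>2) = 0"
    unfolding of_real_eq_0_iff .
  then show ?thesis
    using assms(1,3) by (simp add: sum_nonneg_eq_0_iff)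
qed

lemma mult_cnj_self_nonneg: "0 \<le> z * cnj z"
  by (simp add: less_eq_complex_def)

text \<open>The form at \<open>v\<close> is the sum over \<open>s\<close> of the squared moduli of
  \<open>\<Sum>p\<in>I. cnj (v p) * Z s p\<close>.\<close>

lemma psd_gram:
  "psd I (\<lambda>p q. \<Sum>s\<in>S. Z s p * cnj (Z s q))"
  unfolding psd_def
proof
  fix v :: "_ \<Rightarrow> complex"
  have "(\<Sum>p\<in>I. \<Sum>q\<in>I. cnj (v p) * (\<Sum>s\<in>S. Z s p * cnj (Z s q)) * v q)
      = (\<Sum>p\<in>I. \<Sum>s\<in>S. \<Sum>q\<in>I. (cnj (v p) * Z s p) * (cnj (Z s q) * v q))"
    by (simp add: sum_distrib_left sum_distrib_right mult.assoc)
      (intro sum.cong refl sum.swap)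
  also have "\<dots> = (\<Sum>s\<in>S. \<Sum>p\<in>I. \<Sum>q\<in>I. (cnj (v p) * Z s p) * (cnj (Z s q) * v q))"
    by (rule sum.swap)
  also have "\<dots> = (\<Sum>s\<in>S. (\<Sum>p\<in>I. cnj (v p) * Z s p) * cnj (\<Sum>p\<in>I. cnj (v p) * Z s p))"
    unfolding cnj_sum sum_product by (intro sum.cong refl) (simp add: mult_ac)
  also have "0 \<le> \<dots>"
    by (intro sum_nonneg mult_cnj_self_nonneg)
  finally show "0 \<le> (\<Sum>p\<in>I. \<Sum>q\<in>I. cnj (v p) * (\<Sum>s\<in>S. Z s p * cnj (Z s q)) * v q)" .
qed

text \<open>In matrix terms \<open>Z Z^* = K = T T^*\<close>, \<open>T = K c\<close> and
  \<open>\<beta> = c^* Z\<close>. Hence \<open>Z \<beta>^* = K c = T\<close>, and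
  \<open>\<beta> \<beta>^* = c^* T\<close> is the same for every family with Gram matrix
  \<open>K\<close>. Finally \<open>T \<beta> = Z\<close>, because each row of the difference has
  norm 0.\<close>

lemma gram_expansion:
  fixes Z :: "'s \<Rightarrow> 'i \<Rightarrow> complex" and T c :: "'u \<Rightarrow> 'i \<Rightarrow> complex"
  assumes fin: "finite S"
    and gram: "\<And>p q. p \<in> I \<Longrightarrow> q \<in> I \<Longrightarrow> (\<Sum>s\<in>S. Z s p * cnj (Z s q)) = K p q"
    and T: "\<And>u p. u \<in> U \<Longrightarrow> p \<in> I \<Longrightarrow> T u p = (\<Sum>q\<in>I. K p q * c u q)"
    and K: "\<And>p q. p \<in> I \<Longrightarrow> q \<in> I \<Longrightarrow> K p q = (\<Sum>u\<in>U. T u p * cnj (T u q))"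
    and \<beta>: "\<And>u s. \<beta> u s = (\<Sum>q\<in>I. cnj (c u q) * Z s q)"
  shows "u \<in> U \<Longrightarrow> p \<in> I \<Longrightarrow> (\<Sum>s\<in>S. Z s p * cnj (\<beta> u s)) = T u p"
    and "u \<in> U \<Longrightarrow> u' \<in> U \<Longrightarrow> (\<Sum>s\<in>S. \<beta> u s * cnj (\<beta> u' s)) = (\<Sum>q\<in>I. cnj (c u q) * T u' q)"
    and "s \<in> S \<Longrightarrow> p \<in> I \<Longrightarrow> (\<Sum>u\<in>U. T u p * \<beta> u s) = Z s p"
proof -
  show b: "(\<Sum>s\<in>S. Z s p * cnj (\<beta> u s)) = T u p" if "u \<in> U" "p \<in> I" for u p
  proof -
    have "(\<Sum>s\<in>S. Z s p * cnj (\<beta> u s)) = (\<Sum>s\<in>S. \<Sum>q\<in>I. Z s p * cnj (Z s q) * c u q)"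
      by (simp add: \<beta> sum_distrib_left mult_ac)
    also have "\<dots> = (\<Sum>q\<in>I. \<Sum>s\<in>S. Z s p * cnj (Z s q) * c u q)"
      by (rule sum.swap)
    also have "\<dots> = T u p"
      using that by (simp add: T gram[symmetric] sum_distrib_right)
    finally show ?thesis .
  qed
  show n: "(\<Sum>s\<in>S. \<beta> u s * cnj (\<beta> u' s)) = (\<Sum>q\<in>I. cnj (c u q) * T u' q)"
    if "u \<in> U" "u' \<in> U" for u u'
  proof -
    have "(\<Sum>s\<in>S. \<beta> u s * cnj (\<beta> u' s))
        = (\<Sum>s\<in>S. \<Sum>q\<in>I. cnj (c u q) * (Z s q * cnj (\<beta> u' s)))"
      by (simp add: \<beta>[of u] sum_distrib_right mult.assoc)
    also have "\<dots> = (\<Sum>q\<in>I. \<Sum>s\<in>S. cnj (c u q) * (Z s q * cnj (\<beta> u' s)))"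
      by (rule sum.swap)
    also have "\<dots> = (\<Sum>q\<in>I. cnj (c u q) * T u' q)"
      using that by (simp add: b sum_distrib_left[symmetric])
    finally show ?thesis .
  qed
  show "(\<Sum>u\<in>U. T u p * \<beta> u s) = Z s p" if s: "s \<in> S" and p: "p \<in> I" for s p
  proof -
    define z where "z s = (\<Sum>u\<in>U. T u p * \<beta> u s)" for s
    have Kd: "K p p = (\<Sum>u\<in>U. T u p * cnj (T u p))"
      using K p by blast
    have 1: "(\<Sum>s\<in>S. Z s p * cnj (z s)) = K p p"
    proof -
      have "(\<Sum>s\<in>S. Z s p * cnj (z s)) = (\<Sum>s\<in>S. \<Sum>u\<in>U. cnj (T u p) * (Z s p * cnj (\<beta> u s)))"
        by (simp add: z_def sum_distrib_left mult_ac)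
      also have "\<dots> = (\<Sum>u\<in>U. \<Sum>s\<in>S. cnj (T u p) * (Z s p * cnj (\<beta> u s)))"
        by (rule sum.swap)
      also have "\<dots> = K p p"
        using p by (simp add: b Kd sum_distrib_left[symmetric] mult.commute)
      finally show ?thesis .
    qed
    have "(\<Sum>s\<in>S. z s * cnj (Z s p)) = cnj (\<Sum>s\<in>S. Z s p * cnj (z s))"
      by (simp add: mult.commute)
    also have "\<dots> = K p p"
      unfolding 1 Kd by (simp add: mult.commute)
    finally have 2: "(\<Sum>s\<in>S. z s * cnj (Z s p)) = K p p" .
    have 3: "(\<Sum>s\<in>S. z s * cnj (z s)) = K p p"
    proof -
      \<comment> \<open>\<open>\<beta> \<beta>^* T^* = c^* T T^* = c^* K = T^*\<close>, the last
        step because \<open>K\<close> is hermitian.\<close>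
      have u: "(\<Sum>s\<in>S. \<beta> u s * cnj (z s)) = cnj (T u p)" if u: "u \<in> U" for u
      proof -
        have "(\<Sum>s\<in>S. \<beta> u s * cnj (z s))
            = (\<Sum>s\<in>S. \<Sum>u'\<in>U. cnj (T u' p) * (\<beta> u s * cnj (\<beta> u' s)))"
          by (simp add: z_def sum_distrib_left mult_ac)
        also have "\<dots> = (\<Sum>u'\<in>U. \<Sum>s\<in>S. cnj (T u' p) * (\<beta> u s * cnj (\<beta> u' s)))"
          by (rule sum.swap)
        also have "\<dots> = (\<Sum>u'\<in>U. cnj (T u' p) * (\<Sum>q\<in>I. cnj (c u q) * T u' q))"
          using u by (simp add: n sum_distrib_left[symmetric])
        also have "\<dots> = (\<Sum>u'\<in>U. \<Sum>q\<in>I. cnj (c u q) * (T u' q * cnj (T u' p)))"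
          by (simp add: sum_distrib_left mult_ac)
        also have "\<dots> = (\<Sum>q\<in>I. \<Sum>u'\<in>U. cnj (c u q) * (T u' q * cnj (T u' p)))"
          by (rule sum.swap)
        also have "\<dots> = (\<Sum>q\<in>I. cnj (c u q) * K q p)"
          using p by (simp add: K sum_distrib_left[symmetric])
        also have "\<dots> = (\<Sum>q\<in>I. cnj (K p q * c u q))"
          using p by (intro sum.cong refl) (simp add: K mult_ac)
        also have "\<dots> = cnj (T u p)"
          using u p by (simp add: T)
        finally show ?thesis .
      qed
      have "(\<Sum>s\<in>S. z s * cnj (z s)) = (\<Sum>s\<in>S. \<Sum>u\<in>U. T u p * (\<beta> u s * cnj (z s)))"
        by (subst (1) z_def) (simp add: sum_distrib_right mult.assoc)
      also have "\<dots> = (\<Sum>u\<in>U. \<Sum>s\<in>S. T u p * (\<beta> u s * cnj (z s)))"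
        by (rule sum.swap)
      also have "\<dots> = K p p"
        by (simp add: u Kd sum_distrib_left[symmetric])
      finally show ?thesis .
    qed
    \<comment> \<open>All four products in the expansion sum to \<open>K p p\<close>.\<close>
    have "(\<Sum>s\<in>S. (z s - Z s p) * cnj (z s - Z s p)) = 0"
      using 1 2 3 gram[OF p p] by (simp add: algebra_simps sum.distrib sum_subtractf)
    from sum_mult_cnj_self_eq_0[OF fin this s] show ?thesis
      by (simp add: z_def)
  qed
qed

text \<open>Families with the same Gram matrix, seen as matrices with \<open>A A\<^sup>* = B B\<^sup>*\<close>, are related by
  \<open>[B 0] = A [w e]\<close> for a coisometry \<open>[w e]\<close>. This is the unitary freedom in the choice of Kraus
  operators.\<close>

lemma gram_eq_coisometry:
  fixes A :: "'a \<Rightarrow> 'i \<Rightarrow> complex" and B :: "'b \<Rightarrow> 'i \<Rightarrow> complex"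
  assumes fin: "finite I" "finite S" "finite J"
    and gram: "\<And>p q. p \<in> I \<Longrightarrow> q \<in> I \<Longrightarrow>
      (\<Sum>t\<in>S. A t p * cnj (A t q)) = (\<Sum>j\<in>J. B j p * cnj (B j q))"
  obtains w :: "'a \<Rightarrow> 'b \<Rightarrow> complex" and e :: "'a \<Rightarrow> 'a \<Rightarrow> complex" where
    "\<And>j p. j \<in> J \<Longrightarrow> p \<in> I \<Longrightarrow> (\<Sum>t\<in>S. A t p * w t j) = B j p"
    "\<And>s p. s \<in> S \<Longrightarrow> p \<in> I \<Longrightarrow> (\<Sum>t\<in>S. A t p * e t s) = 0"
    "\<And>t t'. t \<in> S \<Longrightarrow> t' \<in> S \<Longrightarrow>
      (\<Sum>j\<in>J. w t j * cnj (w t' j)) + (\<Sum>s\<in>S. e t s * cnj (e t' s)) = (if t = t' then 1 else 0)"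
proof -
  define K where "K p q = (\<Sum>t\<in>S. A t p * cnj (A t q))" for p q
  have "psd I K"
    using psd_gram[of I A S] by (simp add: K_def[abs_def])
  from psd_factorization[OF fin(1) this] obtain r :: nat and T c where
    T': "\<And>t p. t < r \<Longrightarrow> p \<in> I \<Longrightarrow> T t p = (\<Sum>q\<in>I. K p q * c t q)" and
    K: "\<And>p q. p \<in> I \<Longrightarrow> q \<in> I \<Longrightarrow> K p q = (\<Sum>t<r. T t p * cnj (T t q))"
    by blast
  have T: "T t p = (\<Sum>q\<in>I. K p q * c t q)" if "t \<in> {..<r}" "p \<in> I" for t p
    using T' that by simp
  define \<alpha> where "\<alpha> u t = (\<Sum>q\<in>I. cnj (c u q) * A t q)" for u t
  define \<beta> where "\<beta> u j = (\<Sum>q\<in>I. cnj (c u q) * B j q)" for u j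
  have gA: "(\<Sum>t\<in>S. A t p * cnj (A t q)) = K p q" if "p \<in> I" "q \<in> I" for p q
    by (simp add: K_def)
  have gB: "(\<Sum>t\<in>J. B t p * cnj (B t q)) = K p q" if "p \<in> I" "q \<in> I" for p q
    using gram that by (simp add: K_def)
  note a = gram_expansion[OF fin(2) gA T K \<alpha>_def, simplified]
  note b = gram_expansion[OF fin(3) gB T K \<beta>_def, simplified]
  \<comment> \<open>\<open>P = \<alpha>^* \<alpha>\<close> is the orthogonal projection onto the
    range of \<open>A^*\<close>, \<open>e\<close> is the complementary projection, and
    \<open>w = \<alpha>^* \<beta>\<close> is a partial isometry with
    \<open>w w^* = P\<close>.\<close>
  define w where "w t j = (\<Sum>u<r. cnj (\<alpha> u t) * \<beta> u j)" for t j
  define P where "P t s = (\<Sum>u<r. cnj (\<alpha> u t) * \<alpha> u s)" for t s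
  define e where "e t s = (if t = s then 1 else 0) - P t s" for t s
  \<comment> \<open>One computation serves \<open>w w^*\<close> with
    \<open>\<gamma> = \<beta>\<close> and \<open>P P^*\<close> with
    \<open>\<gamma> = \<alpha>\<close>: in both cases \<open>\<gamma> \<gamma>^* = c^* T\<close>,
    and \<open>c^* T \<alpha> = c^* A = \<alpha>\<close>.\<close>
  have proj: "(\<Sum>j\<in>M. (\<Sum>u<r. cnj (\<alpha> u t) * \<gamma> u j) * cnj (\<Sum>u<r. cnj (\<alpha> u t') * \<gamma> u j)) = P t t'"
    if t: "t \<in> S" "t' \<in> S" and \<gamma>: "\<And>u u'. u < r \<Longrightarrow> u' < r \<Longrightarrow>
      (\<Sum>s\<in>M. \<gamma> u s * cnj (\<gamma> u' s)) = (\<Sum>q\<in>I. cnj (c u q) * T u' q)"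
    for t t' and M :: "'m set" and \<gamma>
  proof -
    have "(\<Sum>j\<in>M. (\<Sum>u<r. cnj (\<alpha> u t) * \<gamma> u j) * cnj (\<Sum>u<r. cnj (\<alpha> u t') * \<gamma> u j))
      = (\<Sum>j\<in>M. \<Sum>u<r. \<Sum>u'<r. cnj (\<alpha> u t) * (\<alpha> u' t' * (\<gamma> u j * cnj (\<gamma> u' j))))"
      unfolding cnj_sum sum_product by (intro sum.cong refl) (simp add: mult_ac)
    also have "\<dots> = (\<Sum>u<r. \<Sum>j\<in>M. \<Sum>u'<r. cnj (\<alpha> u t) * (\<alpha> u' t' * (\<gamma> u j * cnj (\<gamma> u' j))))"
      by (rule sum.swap)
    also have "\<dots> = (\<Sum>u<r. \<Sum>u'<r. \<Sum>j\<in>M. cnj (\<alpha> u t) * (\<alpha> u' t' * (\<gamma> u j * cnj (\<gamma> u' j))))"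
      by (intro sum.cong refl sum.swap)
    also have "\<dots> = (\<Sum>u<r. \<Sum>u'<r. cnj (\<alpha> u t) * (\<alpha> u' t' * (\<Sum>q\<in>I. cnj (c u q) * T u' q)))"
      by (simp add: \<gamma> sum_distrib_left[symmetric])
    also have "\<dots> = (\<Sum>u<r. cnj (\<alpha> u t) * (\<Sum>u'<r. \<Sum>q\<in>I. cnj (c u q) * (T u' q * \<alpha> u' t')))"
      by (simp add: sum_distrib_left mult_ac)
    also have "\<dots> = (\<Sum>u<r. cnj (\<alpha> u t) * (\<Sum>q\<in>I. \<Sum>u'<r. cnj (c u q) * (T u' q * \<alpha> u' t')))"
      by (intro sum.cong refl arg_cong2[of _ _ _ _ "(*)"] sum.swap)
    also have "\<dots> = (\<Sum>u<r. cnj (\<alpha> u t) * \<alpha> u t')"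
    proof -
      have "(\<Sum>q\<in>I. \<Sum>u'<r. cnj (c u q) * (T u' q * \<alpha> u' t')) = \<alpha> u t'" for u
      proof -
        have "(\<Sum>q\<in>I. \<Sum>u'<r. cnj (c u q) * (T u' q * \<alpha> u' t')) = (\<Sum>q\<in>I. cnj (c u q) * A t' q)"
          using t by (simp add: sum_distrib_left[symmetric] a(3) cong: sum.cong)
        then show ?thesis by (simp add: \<alpha>_def)
      qed
      then show ?thesis by simp
    qed
    finally show ?thesis by (simp add: P_def)
  qed
  \<comment> \<open>\<open>A \<alpha>^* = T\<close>, so that \<open>A w = T \<beta> = B\<close> and
    \<open>A P = T \<alpha> = A\<close>.\<close>
  have AP: "(\<Sum>t\<in>S. A t p * (\<Sum>u<r. cnj (\<alpha> u t) * \<gamma> u)) = (\<Sum>u<r. T u p * \<gamma> u)" if "p \<in> I" for p \<gamma>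
  proof -
    have "(\<Sum>t\<in>S. A t p * (\<Sum>u<r. cnj (\<alpha> u t) * \<gamma> u))
        = (\<Sum>t\<in>S. \<Sum>u<r. (A t p * cnj (\<alpha> u t)) * \<gamma> u)"
      by (simp add: sum_distrib_left mult.assoc)
    also have "\<dots> = (\<Sum>u<r. \<Sum>t\<in>S. (A t p * cnj (\<alpha> u t)) * \<gamma> u)"
      by (rule sum.swap)
    also have "\<dots> = (\<Sum>u<r. T u p * \<gamma> u)"
      using that by (simp add: sum_distrib_right[symmetric] a(1))
    finally show ?thesis .
  qed
  show thesis
  proof (rule that)
    show "(\<Sum>t\<in>S. A t p * w t j) = B j p" if "j \<in> J" "p \<in> I" for j p
      using that by (simp add: w_def AP b(3))
    show "(\<Sum>t\<in>S. A t p * e t s) = 0" if "s \<in> S" "p \<in> I" for s p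
    proof -
      have "(\<Sum>t\<in>S. A t p * e t s) = (\<Sum>t\<in>S. (if t = s then A t p else 0) - A t p * P t s)"
        by (intro sum.cong refl) (simp add: e_def algebra_simps)
      also have "\<dots> = A s p - (\<Sum>t\<in>S. A t p * P t s)"
        using fin that by (simp add: sum_subtractf)
      finally have "(\<Sum>t\<in>S. A t p * e t s) = A s p - (\<Sum>t\<in>S. A t p * P t s)" .
      then show ?thesis
        using that by (simp add: P_def AP a(3))
    qed
    show "(\<Sum>j\<in>J. w t j * cnj (w t' j)) + (\<Sum>s\<in>S. e t s * cnj (e t' s)) = (if t = t' then 1 else 0)"
      if t: "t \<in> S" "t' \<in> S" for t t'
    proof -
      have 1: "(\<Sum>j\<in>J. w t j * cnj (w t' j)) = P t t'"
        unfolding w_def using t b(2) by (intro proj) auto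
      have 2: "(\<Sum>s\<in>S. P t s * cnj (P t' s)) = P t t'"
        using proj[OF t, of \<alpha> S] t a(2) by (simp add: P_def[symmetric])
      have "(\<Sum>s\<in>S. e t s * cnj (e t' s)) = (\<Sum>s\<in>S. (if t = s then (if t' = s then 1 else 0) else 0)
          - (if t = s then cnj (P t' s) else 0) - (if t' = s then P t s else 0) + P t s * cnj (P t' s))"
        by (intro sum.cong refl) (simp add: e_def algebra_simps)
      also have "\<dots> = (if t = t' then 1 else 0) - cnj (P t' t) - P t t' + P t t'"
        using fin t by (simp add: sum.distrib sum_subtractf 2)
      also have "cnj (P t' t) = P t t'"
        by (simp add: P_def mult.commute)
      finally show ?thesis
        by (simp add: 1)
    qed
  qed
qed

section \<open>Index arithmetic for Kronecker products, and positive operators as kernels\<close>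

lemma sum_lessThan_mult:
  "(\<Sum>x<a * b. f x) = (\<Sum>i<a. \<Sum>k<b. f (i * b + k))" for f :: "nat \<Rightarrow> 'a::comm_monoid_add"
proof -
  have "(\<Sum>x<a * b. f x) = (\<Sum>i<a. sum f {i * b..<i * b + b})"
    by (rule sum.nat_group[symmetric])
  moreover have "sum f {i * b..<i * b + b} = (\<Sum>k<b. f (i * b + k))" for i
    using sum.shift_bounds_nat_ivl[of f 0 "i * b" b] by (simp add: lessThan_atLeast0 add.commute)
  ultimately show ?thesis by simp
qed

lemma mult_add_less: "i < a \<Longrightarrow> k < b \<Longrightarrow> i * b + k < a * b" for i k a b :: nat
  using mult_le_mono1[of "Suc i" a b] by simp

lemma div_mod_less:
  fixes x a b :: nat
  assumes "x < a * b"
  shows "x div b < a" "x mod b < b"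
proof -
  show "x div b < a" using assms by (simp add: less_mult_imp_div_less)
  have "0 < b" using assms by (cases b) auto
  then show "x mod b < b" by simp
qed

text \<open>Contraction with the maximally entangled vector: equal quotient and remainder single out
  the indices of \<open>e\<^sub>i \<otimes> e\<^sub>i\<close>, and \<open>P\<close> selects one of
  them.\<close>

lemma sum_delta_div_mod:
  fixes f :: "nat \<Rightarrow> 'a::comm_monoid_add"
  assumes "P < a"
  shows "(\<Sum>x<a * a. if x div a = x mod a \<and> P = x mod a then f (x div a) else 0) = f P"
proof -
  have "(\<Sum>x<a * a. if x div a = x mod a \<and> P = x mod a then f (x div a) else 0)
      = (\<Sum>i<a. \<Sum>k<a. if P = k then if i = k then f i else 0 else 0)"
    unfolding sum_lessThan_mult by (intro sum.cong refl) auto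
  also have "\<dots> = f P"
    using assms by simp
  finally show ?thesis .
qed

lemma psd_cong:
  assumes "\<And>p q. p \<in> I \<Longrightarrow> q \<in> I \<Longrightarrow> K p q = K' p q"
  shows "psd I K = psd I K'"
  unfolding psd_def using assms by (simp)

lemma positive_op_iff_psd:
  "positive_op n X \<longleftrightarrow> X \<in> ops n \<and> psd {..<n} (\<lambda>p q. X $$ (p, q))"
proof (cases "X \<in> ops n")
  case True
  have eq: "(X *\<^sub>v vec n v) \<bullet>c vec n v = (\<Sum>p<n. \<Sum>q<n. cnj (v p) * X $$ (p, q) * v q)" for v
    using True by (simp add: scalar_prod_def sum_distrib_left sum_distrib_right lessThan_atLeast0 mult_ac
       )
  have v: "vec n (\<lambda>i. v $ i) = v" if "v \<in> carrier_vec n" for v :: "complex vec"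
    using that by auto
  have "(\<forall>v \<in> carrier_vec n. 0 \<le> (X *\<^sub>v v) \<bullet>c v) \<longleftrightarrow> (\<forall>v. 0 \<le> (X *\<^sub>v vec n v) \<bullet>c vec n v)"
    using v by (metis vec_carrier)
  then show ?thesis
    using True unfolding positive_op_def psd_def eq by simp
qed (simp add: positive_op_def)


section \<open>Arrows of \<open>Quant\<close> and their Choi coefficients\<close>

lemma Quant_simps [simp]:
  "obj Quant = UNIV" "src Quant = qsrc" "tgt Quant = qtgt"
  by (simp_all add: Quant_def)

lemma comp_Quant:
  "comp Quant g f = QArrow (qsrc f) (qtgt g) (compose (ops (qsrc f)) (qmap g) (qmap f))"
  by (simp add: Quant_def)

lemma tensor_Quant:
  "tensor Quant f g = QArrow (qsrc f * qsrc g) (qtgt f * qtgt g)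
     (restrict (tensor_map (qsrc f) (qtgt f) (qsrc g) (qtgt g) (qmap f) (qmap g))
       (ops (qsrc f * qsrc g)))"
  by (simp add: Quant_def)

lemma qsrc_tgt_Quant [simp]:
  "qsrc (comp Quant g f) = qsrc f" "qtgt (comp Quant g f) = qtgt g"
  "qsrc (tensor Quant f g) = qsrc f * qsrc g" "qtgt (tensor Quant f g) = qtgt f * qtgt g"
  by (simp_all add: Quant_def)

text \<open>Arrows without positivity. Equations between composites and tensor products can then be
  checked without first showing that these are completely positive.\<close>

definition linear_arrow :: "qarrow \<Rightarrow> bool" where
  "linear_arrow x \<longleftrightarrow> qmap x \<in> extensional (ops (qsrc x)) \<and> linear_on_ops (qsrc x) (qtgt x) (qmap x)"

lemma arr_Quant_iff:
  "x \<in> arr Quant \<longleftrightarrow> qmap x \<in> extensional (ops (qsrc x)) \<and> completely_positive (qsrc x) (qtgt x) (qmap x)"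
  by (cases x) (auto simp: Quant_def)

lemma linear_arrow_arr: "x \<in> arr Quant \<Longrightarrow> linear_arrow x"
  by (simp add: arr_Quant_iff linear_arrow_def completely_positive_def)

text \<open>The Choi matrix has the pairs \<open>(p, i)\<close> and \<open>(q, j)\<close> as row and column indices.\<close>

definition choi :: "qarrow \<Rightarrow> nat \<Rightarrow> nat \<Rightarrow> nat \<Rightarrow> nat \<Rightarrow> complex" where
  "choi x p i q j = qmap x (matrix_unit (qsrc x) i j) $$ (p, q)"

lemma matrix_unit_ops [simp]: "matrix_unit n i j \<in> ops n"
  by (simp add: matrix_unit_def)

lemma qmap_ops: "linear_arrow x \<Longrightarrow> X \<in> ops (qsrc x) \<Longrightarrow> qmap x X \<in> ops (qtgt x)"
  by (auto simp: linear_arrow_def linear_on_ops_def)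

lemma qmap_entry:
  assumes "linear_arrow x" "X \<in> ops (qsrc x)" "p < qtgt x" "q < qtgt x"
  shows "qmap x X $$ (p, q) = (\<Sum>i<qsrc x. \<Sum>j<qsrc x. X $$ (i, j) * choi x p i q j)"
  unfolding choi_def by (rule linear_on_ops_expand) (use assms in \<open>auto simp: linear_arrow_def\<close>)

text \<open>The matrix units span, so a linear map is determined by its Choi coefficients; outside
  \<open>ops\<close>, extensionality settles equality.\<close>

lemma arrow_eqI:
  assumes lin: "linear_arrow x" "linear_arrow y"
    and st: "qsrc x = qsrc y" "qtgt x = qtgt y"
    and choi: "\<And>p i q j. p < qtgt y \<Longrightarrow> q < qtgt y \<Longrightarrow> i < qsrc y \<Longrightarrow> j < qsrc y \<Longrightarrow>
      choi x p i q j = choi y p i q j"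
  shows "x = y"
proof -
  have "qmap x X = qmap y X" for X
  proof (cases "X \<in> ops (qsrc y)")
    case True
    show ?thesis
    proof (rule eq_matI)
      fix p q assume "p < dim_row (qmap y X)" "q < dim_col (qmap y X)"
      then have "p < qtgt y" "q < qtgt y"
        using qmap_ops[OF lin(2) True] by auto
      then show "qmap x X $$ (p, q) = qmap y X $$ (p, q)"
        using True st choi by (simp add: qmap_entry lin)
    qed (use qmap_ops[OF lin(1), of X] qmap_ops[OF lin(2) True] True st in auto)
  next
    case False
    then show ?thesis
      using lin st by (auto simp: linear_arrow_def extensional_def)
  qed
  then show ?thesis
    using st by (intro qarrow.expand) auto
qed

lemma linear_arrow_comp:
  assumes "linear_arrow f" "linear_arrow g" "qtgt f = qsrc g"
  shows "linear_arrow (comp Quant g f)"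
  using assms unfolding linear_arrow_def linear_on_ops_def comp_Quant
  by (auto simp: compose_def)

text \<open>With index pairs \<open>(p, q)\<close> and \<open>(i, j)\<close> the Choi coefficients
  form the matrix of the linear map, so composition is matrix multiplication.\<close>

lemma choi_comp:
  assumes "linear_arrow f" "linear_arrow g" "qtgt f = qsrc g" "p < qtgt g" "q < qtgt g"
  shows "choi (comp Quant g f) p i q j =
    (\<Sum>x<qtgt f. \<Sum>y<qtgt f. choi g p x q y * choi f x i y j)"
proof -
  have "choi (comp Quant g f) p i q j = qmap g (qmap f (matrix_unit (qsrc f) i j)) $$ (p, q)"
    by (simp add: choi_def comp_Quant compose_def)
  also have "\<dots> = (\<Sum>x<qtgt f. \<Sum>y<qtgt f. choi f x i y j * choi g p x q y)"
    using assms qmap_ops[OF assms(1)] by (subst qmap_entry) (simp_all add: choi_def)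
  finally show ?thesis
    by (simp add: mult.commute)
qed

lemma linear_arrow_tensor: "linear_arrow (tensor Quant f g)"
proof -
  have idx: "k + i * a' < a * a'" if "i < a" "k < a'" for i k a a' :: nat
    using mult_add_less[OF that] by (simp add: add.commute)
  show ?thesis
    unfolding linear_arrow_def linear_on_ops_def tensor_Quant
    by (auto simp: tensor_map_def idx algebra_simps sum.distrib sum_distrib_left
        intro!: eq_matI)
qed

lemma kron_matrix_unit:
  assumes "i < a * b" "j < a * b"
  shows "kron (matrix_unit a (i div b) (j div b)) (matrix_unit b (i mod b) (j mod b)) =
    matrix_unit (a * b) i j"
proof (rule eq_matI)
  fix p q assume "p < dim_row (matrix_unit (a * b) i j)" "q < dim_col (matrix_unit (a * b) i j)"
  then have pq: "p < a * b" "q < a * b"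
    by (auto simp: matrix_unit_def)
  have eq: "x = y \<longleftrightarrow> x div b = y div b \<and> x mod b = y mod b" for x y
    by (metis div_mult_mod_eq)
  show "kron (matrix_unit a (i div b) (j div b)) (matrix_unit b (i mod b) (j mod b)) $$ (p, q) =
      matrix_unit (a * b) i j $$ (p, q)"
    using pq div_mod_less[OF pq(1)] div_mod_less[OF pq(2)]
    by (simp add: kron_def matrix_unit_def eq[of p i] eq[of q j])
qed (simp_all add: kron_def matrix_unit_def)

text \<open>Matrix units of a tensor product are Kronecker products of matrix units.\<close>

lemma choi_tensor:
  assumes lin: "linear_arrow f" "linear_arrow g"
    and ij: "i < qsrc f * qsrc g" "j < qsrc f * qsrc g"
    and pq: "p < qtgt f * qtgt g" "q < qtgt f * qtgt g"
  shows "choi (tensor Quant f g) p i q j =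
    choi f (p div qtgt g) (i div qsrc g) (q div qtgt g) (j div qsrc g) *
    choi g (p mod qtgt g) (i mod qsrc g) (q mod qtgt g) (j mod qsrc g)"
proof -
  let ?E = "matrix_unit (qsrc f) (i div qsrc g) (j div qsrc g)"
  let ?E' = "matrix_unit (qsrc g) (i mod qsrc g) (j mod qsrc g)"
  have "choi (tensor Quant f g) p i q j =
      tensor_map (qsrc f) (qtgt f) (qsrc g) (qtgt g) (qmap f) (qmap g) (kron ?E ?E') $$ (p, q)"
    using ij by (simp add: choi_def tensor_Quant kron_matrix_unit)
  also have "\<dots> = kron (qmap f ?E) (qmap g ?E') $$ (p, q)"
    using lin by (subst tensor_map_kron) (auto simp: linear_arrow_def)
  also have "\<dots> = choi f (p div qtgt g) (i div qsrc g) (q div qtgt g) (j div qsrc g) *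
    choi g (p mod qtgt g) (i mod qsrc g) (q mod qtgt g) (j mod qsrc g)"
    using qmap_ops[OF lin(1), of ?E] qmap_ops[OF lin(2), of ?E'] pq
    by (simp add: kron_def choi_def)
  finally show ?thesis .
qed


section \<open>Kraus representations\<close>

text \<open>The map \<open>X \<mapsto> \<Sum>\<^sub>t K\<^sub>t X K\<^sub>t\<^sup>*\<close> in
  entries. The index type is free because pure maps use \<open>unit\<close>, Choi factorizations use
  numbers, and fillers use a disjoint sum.\<close>

definition kraus_arrow :: "nat \<Rightarrow> nat \<Rightarrow> 'k set \<Rightarrow> ('k \<Rightarrow> nat \<Rightarrow> nat \<Rightarrow> complex) \<Rightarrow> qarrow" where
  "kraus_arrow a b S K = QArrow a b (restrict (\<lambda>X. mat b b (\<lambda>(p, q).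
     \<Sum>t\<in>S. \<Sum>i<a. \<Sum>j<a. X $$ (i, j) * (K t p i * cnj (K t q j)))) (ops a))"

lemma qsrc_tgt_kraus_arrow [simp]:
  "qsrc (kraus_arrow a b S K) = a" "qtgt (kraus_arrow a b S K) = b"
  by (simp_all add: kraus_arrow_def)

lemma linear_arrow_kraus: "linear_arrow (kraus_arrow a b S K)"
  unfolding linear_arrow_def linear_on_ops_def kraus_arrow_def
  by (auto simp: algebra_simps sum.distrib sum_distrib_left intro!: eq_matI)

lemma sum_matrix_unit:
  assumes "i < a" "j < a"
  shows "(\<Sum>x<a. \<Sum>y<a. matrix_unit a i j $$ (x, y) * f x y) = f i j"
proof -
  have "(\<Sum>x<a. \<Sum>y<a. matrix_unit a i j $$ (x, y) * f x y)
      = (\<Sum>x<a. \<Sum>y<a. if y = j then if x = i then f x y else 0 else 0)"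
    by (intro sum.cong refl) (simp add: matrix_unit_def)
  then show ?thesis
    using assms by simp
qed

lemma choi_kraus_arrow:
  assumes "i < a" "j < a" "p < b" "q < b"
  shows "choi (kraus_arrow a b S K) p i q j = (\<Sum>t\<in>S. K t p i * cnj (K t q j))"
  using assms by (simp add: choi_def kraus_arrow_def sum_matrix_unit)

lemma mat_adjoint_index:
  "i < dim_col m \<Longrightarrow> j < dim_row m \<Longrightarrow> mat_adjoint m $$ (i, j) = cnj (m $$ (j, i))"
  for m :: "complex mat"
  by (simp add: mat_adjoint_def mat_of_rows_def)

text \<open>A pure map has the single Kraus operator \<open>m\<close>; linearity and complete
  positivity are thus inherited from Kraus arrows.\<close>

lemma quantize_eq_kraus_arrow:
  "quantize m = kraus_arrow (dim_col m) (dim_row m) {()} (\<lambda>_ p i. m $$ (p, i))"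
proof -
  have d: "dim_row (mat_adjoint m) = dim_col m" "dim_col (mat_adjoint m) = dim_row m"
    by (simp_all add: mat_adjoint_def)
  have e: "(m * X * mat_adjoint m) $$ (p, q) =
      (\<Sum>i<dim_col m. \<Sum>j<dim_col m. X $$ (i, j) * (m $$ (p, i) * cnj (m $$ (q, j))))"
    if X: "X \<in> ops (dim_col m)" and pq: "p < dim_row m" "q < dim_row m" for X p q
  proof -
    have "(m * X * mat_adjoint m) $$ (p, q) =
       (\<Sum>j<dim_col m. \<Sum>i<dim_col m. X $$ (i, j) * (m $$ (p, i) * cnj (m $$ (q, j))))"
      using X pq
      by (simp add: scalar_prod_def d mat_adjoint_index sum_distrib_left sum_distrib_right
          lessThan_atLeast0 mult_ac)
    also have "\<dots> = (\<Sum>i<dim_col m. \<Sum>j<dim_col m. X $$ (i, j) * (m $$ (p, i) * cnj (m $$ (q, j))))"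
      by (rule sum.swap)
    finally show ?thesis .
  qed
  show ?thesis
    unfolding quantize_def kraus_arrow_def
    by (auto simp: d e simp del: index_mult_mat(1) intro!: restrict_ext eq_matI)
qed

lemma qsrc_tgt_quantize [simp]: "qsrc (quantize m) = dim_col m" "qtgt (quantize m) = dim_row m"
  by (simp_all add: quantize_def)

lemma linear_arrow_quantize: "linear_arrow (quantize m)"
  unfolding quantize_eq_kraus_arrow by (rule linear_arrow_kraus)

lemma choi_quantize:
  "i < dim_col m \<Longrightarrow> j < dim_col m \<Longrightarrow> p < dim_row m \<Longrightarrow> q < dim_row m \<Longrightarrow>
    choi (quantize m) p i q j = m $$ (p, i) * cnj (m $$ (q, j))"
  unfolding quantize_eq_kraus_arrow by (simp add: choi_kraus_arrow)

lemma ident_Quant: "ident Quant n = quantize (1\<^sub>m n)"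
proof -
  have "mat_adjoint (1\<^sub>m n) = (1\<^sub>m n :: complex mat)"
    by (rule eq_matI) (auto simp: mat_adjoint_index, auto simp: mat_adjoint_def)
  then show ?thesis
    by (auto simp: Quant_def quantize_def intro!: restrict_ext)
qed

lemma quantize_mult:
  assumes "dim_row f = dim_col g"
  shows "comp Quant (quantize g) (quantize f) = quantize (g * f)"
proof (rule arrow_eqI)
  fix p i q j
  assume "p < qtgt (quantize (g * f))" "q < qtgt (quantize (g * f))"
    "i < qsrc (quantize (g * f))" "j < qsrc (quantize (g * f))"
  then show "choi (comp Quant (quantize g) (quantize f)) p i q j = choi (quantize (g * f)) p i q j"
    using assms
    by (simp add: choi_comp linear_arrow_quantize choi_quantize scalar_prod_def sum_product
        lessThan_atLeast0 mult_ac)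
qed (use assms in \<open>simp_all add: linear_arrow_quantize linear_arrow_comp\<close>)

lemma quantize_kron: "tensor Quant (quantize f) (quantize g) = quantize (kron f g)"
proof (rule arrow_eqI)
  fix p i q j
  assume "p < qtgt (quantize (kron f g))" "q < qtgt (quantize (kron f g))"
    "i < qsrc (quantize (kron f g))" "j < qsrc (quantize (kron f g))"
  then have b: "p < dim_row f * dim_row g" "q < dim_row f * dim_row g"
    "i < dim_col f * dim_col g" "j < dim_col f * dim_col g"
    by (simp_all add: kron_def)
  show "choi (tensor Quant (quantize f) (quantize g)) p i q j = choi (quantize (kron f g)) p i q j"
    using b div_mod_less[OF b(1)] div_mod_less[OF b(2)] div_mod_less[OF b(3)] div_mod_less[OF b(4)]
    by (simp add: choi_tensor linear_arrow_quantize choi_quantize)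
      (simp add: kron_def choi_quantize)
qed (simp_all add: linear_arrow_quantize linear_arrow_tensor, simp_all add: kron_def)

text \<open>If \<open>X = \<Sum>\<^sub>s T\<^sub>s T\<^sub>s\<^sup>*\<close>, the image is the Gram
  kernel of the vectors \<open>K\<^sub>t T\<^sub>s\<close>, here \<open>Z (t, s)\<close>.\<close>

lemma positive_op_kraus:
  assumes "positive_op a X"
  shows "positive_op b (qmap (kraus_arrow a b S K) X)"
proof -
  have X: "X \<in> ops a" and "psd {..<a} (\<lambda>p q. X $$ (p, q))"
    using assms by (auto simp: positive_op_iff_psd)
  from psd_factorization[OF _ this(2)] obtain r :: nat and T where
    T: "\<And>p q. p < a \<Longrightarrow> q < a \<Longrightarrow> X $$ (p, q) = (\<Sum>s<r. T s p * cnj (T s q))"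
    by auto
  define Z where "Z u p = (\<Sum>i<a. K (fst u) p i * T (snd u) i)" for u p
  have "qmap (kraus_arrow a b S K) X $$ (p, q) = (\<Sum>u\<in>S \<times> {..<r}. Z u p * cnj (Z u q))"
    if pq: "p < b" "q < b" for p q
  proof -
    have inner: "(\<Sum>i<a. \<Sum>j<a. X $$ (i, j) * (K t p i * cnj (K t q j)))
        = (\<Sum>s<r. Z (t, s) p * cnj (Z (t, s) q))" for t
    proof -
      have "(\<Sum>i<a. \<Sum>j<a. X $$ (i, j) * (K t p i * cnj (K t q j)))
          = (\<Sum>i<a. \<Sum>j<a. \<Sum>s<r. (K t p i * T s i) * cnj (K t q j * T s j))"
        by (intro sum.cong refl) (simp add: T sum_distrib_left sum_distrib_right mult_ac)
      also have "\<dots> = (\<Sum>i<a. \<Sum>s<r. \<Sum>j<a. (K t p i * T s i) * cnj (K t q j * T s j))"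
        by (intro sum.cong refl sum.swap)
      also have "\<dots> = (\<Sum>s<r. \<Sum>i<a. \<Sum>j<a. (K t p i * T s i) * cnj (K t q j * T s j))"
        by (rule sum.swap)
      also have "\<dots> = (\<Sum>s<r. Z (t, s) p * cnj (Z (t, s) q))"
        by (simp add: Z_def sum_product)
      finally show ?thesis .
    qed
    have "(\<Sum>u\<in>S \<times> {..<r}. Z u p * cnj (Z u q)) = (\<Sum>t\<in>S. \<Sum>s<r. Z (t, s) p * cnj (Z (t, s) q))"
      by (simp add: sum.cartesian_product case_prod_beta)
    then show ?thesis
      using X pq by (simp add: kraus_arrow_def inner)
  qed
  then have "psd {..<b} (\<lambda>p q. qmap (kraus_arrow a b S K) X $$ (p, q))
      = psd {..<b} (\<lambda>p q. \<Sum>u\<in>S \<times> {..<r}. Z u p * cnj (Z u q))"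
    by (intro psd_cong) auto
  then show ?thesis
    using qmap_ops[OF linear_arrow_kraus, of X a b S K] X psd_gram
    by (simp add: positive_op_iff_psd)
qed

lemma tensor_ident:
  assumes "X \<in> ops (qsrc x * k)"
  shows "qmap (tensor Quant x (ident Quant k)) X =
    tensor_map (qsrc x) (qtgt x) k k (qmap x) (\<lambda>Y. Y) X"
  using assms by (simp add: Quant_def tensor_map_def)

lemma qsrc_tgt_ident [simp]: "qsrc (ident Quant n) = n" "qtgt (ident Quant n) = n"
  by (simp_all add: Quant_def)

lemma linear_arrow_ident: "linear_arrow (ident Quant n)"
  by (simp add: ident_Quant linear_arrow_quantize)

lemma choi_tensor_ident:
  assumes "linear_arrow x" "i < qsrc x * k" "j < qsrc x * k" "p < qtgt x * k" "q < qtgt x * k"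
  shows "choi (tensor Quant x (ident Quant k)) p i q j =
    (if p mod k = i mod k \<and> q mod k = j mod k
     then choi x (p div k) (i div k) (q div k) (j div k) else 0)"
proof -
  have c: "choi (ident Quant k) p i q j = (if p = i \<and> q = j then 1 else 0)"
    if "p < k" "i < k" "q < k" "j < k" for p i q j
    unfolding ident_Quant using that by (simp add: choi_quantize)
  have k: "0 < k"
    using assms(2) by (cases k) auto
  show ?thesis
    using assms k by (simp add: choi_tensor linear_arrow_ident c)
qed

text \<open>Tensoring with an identity replaces each \<open>K\<^sub>t\<close> by
  \<open>K\<^sub>t \<otimes> 1\<close>, here \<open>?K\<close>, so complete positivity reduces to
  positivity of Kraus arrows.\<close>

lemma kraus_arrow_in_arr: "kraus_arrow a b S K \<in> arr Quant"
proof -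
  let ?x = "kraus_arrow a b S K"
  have "positive_op (b * k) (tensor_map a b k k (qmap ?x) (\<lambda>Y. Y) X)"
    if X: "positive_op (a * k) X" for k X
  proof -
    let ?K = "\<lambda>t p i. if p mod k = i mod k then K t (p div k) (i div k) else 0"
    have "tensor Quant ?x (ident Quant k) = kraus_arrow (a * k) (b * k) S ?K"
    proof (rule arrow_eqI)
      fix p i q j
      assume "p < qtgt (kraus_arrow (a * k) (b * k) S ?K)" "q < qtgt (kraus_arrow (a * k) (b * k) S ?K)"
        "i < qsrc (kraus_arrow (a * k) (b * k) S ?K)" "j < qsrc (kraus_arrow (a * k) (b * k) S ?K)"
      then have b: "p < b * k" "q < b * k" "i < a * k" "j < a * k"
        by simp_all
      then show "choi (tensor Quant ?x (ident Quant k)) p i q j =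
          choi (kraus_arrow (a * k) (b * k) S ?K) p i q j"
        by (auto simp: choi_tensor_ident linear_arrow_kraus choi_kraus_arrow div_mod_less)
    qed (simp_all add: linear_arrow_tensor linear_arrow_kraus)
    then have "qmap (tensor Quant ?x (ident Quant k)) X = qmap (kraus_arrow (a * k) (b * k) S ?K) X"
      by simp
    then show ?thesis
      using positive_op_kraus[OF X, of "b * k" S ?K] tensor_ident[of X ?x k] X
      by (simp add: positive_op_def)
  qed
  then show ?thesis
    using linear_arrow_kraus[of a b S K]
    by (simp add: arr_Quant_iff completely_positive_def linear_arrow_def)
qed

lemma quantize_in_arr: "quantize m \<in> arr Quant"
  unfolding quantize_eq_kraus_arrow by (rule kraus_arrow_in_arr)

text \<open>The vector \<open>\<Sum>\<^sub>i e\<^sub>i \<otimes> e\<^sub>i\<close>; applying \<open>x \<otimes> id\<close> to the projector on it yields the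
  Choi matrix of \<open>x\<close>.\<close>

definition max_entangled :: "nat \<Rightarrow> nat \<Rightarrow> complex" where
  "max_entangled a i = (if i div a = i mod a then 1 else 0)"

text \<open>The identity factor makes remainders agree and the entangled vector makes quotient and
  remainder agree, so one term is left in each sum.\<close>

lemma sum_max_entangled:
  assumes lin: "linear_arrow x" and p: "p < qtgt x * qsrc x" and q: "q < qtgt x * qsrc x"
  defines "a \<equiv> qsrc x"
  shows "(\<Sum>i<a * a. \<Sum>j<a * a. choi (tensor Quant x (ident Quant a)) p i q j *
      (max_entangled a i * cnj (max_entangled a j)))
    = choi x (p div a) (p mod a) (q div a) (q mod a)"
proof -
  note pq = p[folded a_def] q[folded a_def]
  have c: "choi (tensor Quant x (ident Quant a)) p i q j = (if p mod a = i mod a \<and> q mod a = j mod a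
     then choi x (p div a) (i div a) (q div a) (j div a) else 0)" if "i < a * a" "j < a * a" for i j
    using that pq lin unfolding a_def by (simp add: choi_tensor_ident)
  have "(\<Sum>i<a * a. \<Sum>j<a * a. choi (tensor Quant x (ident Quant a)) p i q j *
      (max_entangled a i * cnj (max_entangled a j)))
    = (\<Sum>i<a * a. if i div a = i mod a \<and> p mod a = i mod a then
        (\<Sum>j<a * a. if j div a = j mod a \<and> q mod a = j mod a
          then choi x (p div a) (i div a) (q div a) (j div a) else 0) else 0)"
    by (simp add: c max_entangled_def if_distrib[of "\<lambda>y. y * _"])
      (auto intro!: sum.cong sum.neutral)
  also have "\<dots> = (\<Sum>j<a * a. if j div a = j mod a \<and> q mod a = j mod a
          then choi x (p div a) (p mod a) (q div a) (j div a) else 0)"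
    by (rule sum_delta_div_mod[OF div_mod_less(2)[OF pq(1)], where f = "\<lambda>i. \<Sum>j<a * a.
        if j div a = j mod a \<and> q mod a = j mod a
        then choi x (p div a) i (q div a) (j div a) else 0"])
  also have "\<dots> = choi x (p div a) (p mod a) (q div a) (q mod a)"
    by (rule sum_delta_div_mod[OF div_mod_less(2)[OF pq(2)],
        where f = "choi x (p div a) (p mod a) (q div a)"])
  finally show ?thesis .
qed

text \<open>Choi's theorem. Complete positivity with an ancilla of dimension \<open>qsrc x\<close>
  makes the Choi matrix positive, and a factorization of it yields the Kraus operators.\<close>

lemma arr_obtain_kraus:
  assumes x: "x \<in> arr Quant"
  obtains r :: nat and K where "x = kraus_arrow (qsrc x) (qtgt x) {..<r} K"
proof -
  let ?a = "qsrc x" and ?b = "qtgt x" and ?\<omega> = "max_entangled (qsrc x)"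
  note lin = linear_arrow_arr[OF x]
  define \<Omega> where "\<Omega> = mat (?a * ?a) (?a * ?a) (\<lambda>(i, j). ?\<omega> i * cnj (?\<omega> j))"
  have \<Omega>: "\<Omega> \<in> ops (?a * ?a)"
    by (simp add: \<Omega>_def)
  have "psd {..<?a * ?a} (\<lambda>p q. \<Omega> $$ (p, q)) = psd {..<?a * ?a} (\<lambda>p q. \<Sum>s\<in>{()}. ?\<omega> p * cnj (?\<omega> q))"
    by (intro psd_cong) (simp add: \<Omega>_def)
  then have "positive_op (?a * ?a) \<Omega>"
    using \<Omega> psd_gram[of "{..<?a * ?a}" "\<lambda>_. ?\<omega>" "{()}"] by (simp add: positive_op_iff_psd)
  then have "positive_op (?b * ?a) (qmap (tensor Quant x (ident Quant ?a)) \<Omega>)"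
    using x \<Omega> by (simp add: arr_Quant_iff completely_positive_def tensor_ident)
  then have "psd {..<?b * ?a} (\<lambda>p q. qmap (tensor Quant x (ident Quant ?a)) \<Omega> $$ (p, q))"
    by (simp add: positive_op_iff_psd)
  from psd_factorization[OF _ this] obtain r :: nat and T where
    T: "\<And>p q. p < ?b * ?a \<Longrightarrow> q < ?b * ?a \<Longrightarrow>
      qmap (tensor Quant x (ident Quant ?a)) \<Omega> $$ (p, q) = (\<Sum>t<r. T t p * cnj (T t q))"
    by auto
  have entry: "qmap (tensor Quant x (ident Quant ?a)) \<Omega> $$ (p, q) =
      choi x (p div ?a) (p mod ?a) (q div ?a) (q mod ?a)" if "p < ?b * ?a" "q < ?b * ?a" for p q
    using that \<Omega> sum_max_entangled[OF lin that]
    by (subst qmap_entry) (simp_all add: linear_arrow_tensor \<Omega>_def mult.commute)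
  \<comment> \<open>The vector \<open>T t\<close> has index set \<open>?b * ?a\<close>; it is
    reshaped into a matrix with \<open>?b\<close> rows and \<open>?a\<close> columns.\<close>
  have "x = kraus_arrow ?a ?b {..<r} (\<lambda>t p i. T t (p * ?a + i))"
  proof (rule arrow_eqI)
    fix p i q j
    let ?y = "kraus_arrow ?a ?b {..<r} (\<lambda>t p i. T t (p * ?a + i))"
    assume "p < qtgt ?y" "q < qtgt ?y" "i < qsrc ?y" "j < qsrc ?y"
    then have b: "p < ?b" "q < ?b" "i < ?a" "j < ?a"
      by simp_all
    then show "choi x p i q j = choi ?y p i q j"
      using T[of "p * ?a + i" "q * ?a + j"] by (simp add: choi_kraus_arrow entry mult_add_less)
  qed (simp_all add: lin linear_arrow_kraus)
  then show thesis
    by (rule that)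
qed

section \<open>Completely mixed states and partial traces\<close>

lemma qsrc_tgt_mixed_state [simp]: "qsrc (mixed_state a) = 1" "qtgt (mixed_state a) = a"
  by (simp_all add: mixed_state_def)

lemma linear_arrow_mixed_state: "linear_arrow (mixed_state a)"
  unfolding linear_arrow_def linear_on_ops_def mixed_state_def
  by (auto simp: algebra_simps intro!: eq_matI)

lemma choi_mixed_state:
  "p < a \<Longrightarrow> q < a \<Longrightarrow> choi (mixed_state a) p 0 q 0 = (if p = q then 1 else 0)"
  by (simp add: choi_def mixed_state_def matrix_unit_def)

text \<open>Precomposition with \<open>\<mu>\<^sub>a \<otimes> id\<close> is a partial trace on the Choi matrix.\<close>

lemma choi_comp_mixed_state:
  assumes v: "linear_arrow v" "qsrc v = a * k"
    and b: "p < qtgt v" "q < qtgt v" "x < k" "y < k"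
  shows "choi (comp Quant v (tensor Quant (mixed_state a) (ident Quant k))) p x q y
    = (\<Sum>i<a. choi v p (i * k + x) q (i * k + y))"
proof -
  let ?f = "tensor Quant (mixed_state a) (ident Quant k)"
  have c: "choi ?f P x Q y = (if P mod k = x \<and> Q mod k = y \<and> P div k = Q div k then 1 else 0)"
    if "P < a * k" "Q < a * k" for P Q
    using b that div_mod_less[OF that(1)] div_mod_less[OF that(2)]
    by (simp add: choi_tensor_ident linear_arrow_mixed_state choi_mixed_state)
  have "choi (comp Quant v ?f) p x q y =
      (\<Sum>P<a * k. \<Sum>Q<a * k. choi v p P q Q * choi ?f P x Q y)"
    using v b by (subst choi_comp) (simp_all add: linear_arrow_tensor)
  also have "\<dots> = (\<Sum>i<a. \<Sum>x'<k. \<Sum>j<a. \<Sum>y'<k.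
      if y' = y then if j = i then if x' = x then choi v p (i * k + x') q (j * k + y') else 0 else 0 else 0)"
    unfolding sum_lessThan_mult by (intro sum.cong refl) (simp add: c mult_add_less)
  also have "\<dots> = (\<Sum>i<a. choi v p (i * k + x) q (i * k + y))"
    using b by simp
  finally show ?thesis .
qed

text \<open>The product of \<open>x w\<close> with the adjoint of \<open>y w\<close> depends on
  \<open>w\<close> only through \<open>w w^*\<close>; this is where a coisometry relation can be
  inserted.\<close>

lemma sum_mult_cnj_matrix:
  "(\<Sum>j\<in>J. (\<Sum>t\<in>S. x t * w t j) * cnj (\<Sum>t\<in>S. y t * w t j)) =
    (\<Sum>t\<in>S. \<Sum>t'\<in>S. x t * cnj (y t') * (\<Sum>j\<in>J. w t j * cnj (w t' j)))"
proof -
  have "(\<Sum>j\<in>J. (\<Sum>t\<in>S. x t * w t j) * cnj (\<Sum>t\<in>S. y t * w t j)) =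
      (\<Sum>j\<in>J. \<Sum>t\<in>S. \<Sum>t'\<in>S. x t * cnj (y t') * (w t j * cnj (w t' j)))"
    unfolding cnj_sum sum_product by (intro sum.cong refl) (simp add: mult_ac)
  also have "\<dots> = (\<Sum>t\<in>S. \<Sum>j\<in>J. \<Sum>t'\<in>S. x t * cnj (y t') * (w t j * cnj (w t' j)))"
    by (rule sum.swap)
  also have "\<dots> = (\<Sum>t\<in>S. \<Sum>t'\<in>S. \<Sum>j\<in>J. x t * cnj (y t') * (w t j * cnj (w t' j)))"
    by (intro sum.cong refl sum.swap)
  finally show ?thesis
    by (simp add: sum_distrib_left)
qed

text \<open>Composing with \<open>quantize M\<close> multiplies each Kraus operator by
  \<open>M\<close> from the left.\<close>

lemma choi_comp_quantize:
  assumes lin: "linear_arrow x" and d: "qtgt x = dim_col M"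
    and x: "\<And>P Q. P < dim_col M \<Longrightarrow> Q < dim_col M \<Longrightarrow> choi x P i Q j = (\<Sum>t\<in>S. K t P i * cnj (K t Q j))"
    and pq: "p < dim_row M" "q < dim_row M"
  shows "choi (comp Quant (quantize M) x) p i q j =
    (\<Sum>t\<in>S. (\<Sum>P<dim_col M. M $$ (p, P) * K t P i) * cnj (\<Sum>Q<dim_col M. M $$ (q, Q) * K t Q j))"
proof -
  let ?n = "dim_col M"
  have "choi (comp Quant (quantize M) x) p i q j =
      (\<Sum>P<?n. \<Sum>Q<?n. M $$ (p, P) * cnj (M $$ (q, Q)) * (\<Sum>t\<in>S. K t P i * cnj (K t Q j)))"
    using lin d pq by (subst choi_comp) (simp_all add: linear_arrow_quantize choi_quantize x)
  also have "\<dots> = (\<Sum>P<?n. \<Sum>t\<in>S. \<Sum>Q<?n. (M $$ (p, P) * K t P i) * cnj (M $$ (q, Q) * K t Q j))"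
    by (simp add: sum_distrib_left mult_ac) (intro sum.cong refl sum.swap)
  also have "\<dots> = (\<Sum>t\<in>S. \<Sum>P<?n. \<Sum>Q<?n. (M $$ (p, P) * K t P i) * cnj (M $$ (q, Q) * K t Q j))"
    by (rule sum.swap)
  finally show ?thesis
    by (simp add: sum_product)
qed


section \<open>Lifting against completely mixed states\<close>

lemma lifts_against_quantize:
  assumes "a \<noteq> 0"
  shows "lifts_against Quant (tensor Quant (mixed_state a) (ident Quant k)) (quantize M)"
proof -
  let ?f = "tensor Quant (mixed_state a) (ident Quant k)"
  let ?P = "dim_col M" and ?Q = "dim_row M"
  have "\<exists>h \<in> hom Quant (a * k) ?P. comp Quant h ?f = u \<and> comp Quant (quantize M) h = v"
    if u: "u \<in> hom Quant k ?P" and v: "v \<in> hom Quant (a * k) ?Q"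
      and eq: "comp Quant (quantize M) u = comp Quant v ?f" for u v
  proof -
    from u have u': "u \<in> arr Quant" "qsrc u = k" "qtgt u = ?P" by (auto simp: hom_def)
    from v have v': "v \<in> arr Quant" "qsrc v = a * k" "qtgt v = ?Q" by (auto simp: hom_def)
    obtain r :: nat and U where U: "u = kraus_arrow k ?P {..<r} U"
      using arr_obtain_kraus[OF u'(1)] u' by metis
    obtain n :: nat and V where V: "v = kraus_arrow (a * k) ?Q {..<n} V"
      using arr_obtain_kraus[OF v'(1)] v' by metis
    \<comment> \<open>\<open>A\<close> holds the entries of \<open>M U\<^sub>t\<close> and
      \<open>B\<close> those of the blocks \<open>V\<^sub>s\<^sub>,\<^sub>i\<close>. Both are
      indexed by entry positions, so equality of the two maps becomes equality of Gram
      kernels.\<close>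
    define A where "A t = (\<lambda>(p, x). \<Sum>P<?P. M $$ (p, P) * U t P x)" for t
    define B where "B = (\<lambda>(s, i) (p, x). V s p (i * k + x))"
    have gram: "(\<Sum>t<r. A t px * cnj (A t qy)) = (\<Sum>j\<in>{..<n} \<times> {..<a}. B j px * cnj (B j qy))"
      if pq: "px \<in> {..<?Q} \<times> {..<k}" "qy \<in> {..<?Q} \<times> {..<k}" for px qy
    proof -
      obtain p x q y where b: "px = (p, x)" "qy = (q, y)" "p < ?Q" "q < ?Q" "x < k" "y < k"
        using pq by auto
      have "(\<Sum>t<r. A t px * cnj (A t qy)) = choi (comp Quant (quantize M) u) p x q y"
        unfolding b A_def prod.case
        by (rule choi_comp_quantize[symmetric])
          (use b in \<open>simp_all add: U linear_arrow_kraus choi_kraus_arrow\<close>)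
      also have "\<dots> = (\<Sum>i<a. choi v p (i * k + x) q (i * k + y))"
        unfolding eq using b v' linear_arrow_arr[OF v'(1)] by (subst choi_comp_mixed_state) simp_all
      also have "\<dots> = (\<Sum>i<a. \<Sum>s<n. B (s, i) px * cnj (B (s, i) qy))"
        using b by (simp add: V choi_kraus_arrow mult_add_less B_def)
      also have "\<dots> = (\<Sum>s<n. \<Sum>i<a. B (s, i) px * cnj (B (s, i) qy))"
        by (rule sum.swap)
      also have "\<dots> = (\<Sum>j\<in>{..<n} \<times> {..<a}. B j px * cnj (B j qy))"
        by (simp add: sum.cartesian_product case_prod_beta)
      finally show ?thesis .
    qed
    have fin: "finite ({..<?Q} \<times> {..<k})" "finite {..<r}" "finite ({..<n} \<times> {..<a})"
      by simp_all
    obtain w e where wA: "\<And>j px. j \<in> {..<n} \<times> {..<a} \<Longrightarrow> px \<in> {..<?Q} \<times> {..<k} \<Longrightarrow>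
        (\<Sum>t<r. A t px * w t j) = B j px"
      and eA: "\<And>s px. s \<in> {..<r} \<Longrightarrow> px \<in> {..<?Q} \<times> {..<k} \<Longrightarrow> (\<Sum>t<r. A t px * e t s) = 0"
      and we: "\<And>t t'. t \<in> {..<r} \<Longrightarrow> t' \<in> {..<r} \<Longrightarrow>
        (\<Sum>j\<in>{..<n} \<times> {..<a}. w t j * cnj (w t' j)) + (\<Sum>s<r. e t s * cnj (e t' s)) =
        (if t = t' then 1 else 0)"
    proof (rule gram_eq_coisometry[OF fin gram])
    qed (assumption | rule that; assumption)+
    have w: "(\<Sum>t<r. A t (p, x) * w t (s, i)) = V s p (i * k + x)"
      if "s < n" "i < a" "p < ?Q" "x < k" for s i p x
      using wA[of "(s, i)" "(p, x)"] that by (simp add: B_def)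
    have e: "(\<Sum>t<r. A t (p, x) * e t s) = 0" if "s < r" "p < ?Q" "x < k" for s p x
      using eA[of s "(p, x)"] that by simp
    \<comment> \<open>Column \<open>c\<close> lies in block \<open>c div k\<close> at position
      \<open>c mod k\<close>. The \<open>Inl\<close> operators carry \<open>U w\<close>; the
      \<open>Inr\<close> operators carry the defect \<open>U e\<close>, which \<open>M\<close>
      annihilates, in block 0 only.\<close>
    define H where "H z P c = (case z of
        Inl s \<Rightarrow> \<Sum>t<r. U t P (c mod k) * w t (s, c div k)
      | Inr s \<Rightarrow> if c div k = 0 then \<Sum>t<r. U t P (c mod k) * e t s else 0)" for z P c
    define h where "h = kraus_arrow (a * k) ?P ({..<n} <+> {..<r}) H"
    have lh: "linear_arrow h" and sth: "qsrc h = a * k" "qtgt h = ?P" and h: "h \<in> hom Quant (a * k) ?P"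
      by (simp_all add: h_def linear_arrow_kraus hom_def kraus_arrow_in_arr)
    have ch: "choi h P c Q d = (\<Sum>s<n. H (Inl s) P c * cnj (H (Inl s) Q d))
        + (\<Sum>s<r. H (Inr s) P c * cnj (H (Inr s) Q d))"
      if "P < ?P" "Q < ?P" "c < a * k" "d < a * k" for P c Q d
      using that by (simp add: h_def choi_kraus_arrow sum.Plus)
    have "comp Quant h ?f = u"
    proof (rule arrow_eqI)
      fix P x Q y
      assume "P < qtgt u" "Q < qtgt u" "x < qsrc u" "y < qsrc u"
      then have b: "P < ?P" "Q < ?P" "x < k" "y < k"
        using u' by auto
      have w': "(\<Sum>i<a. \<Sum>s<n. H (Inl s) P (i * k + x) * cnj (H (Inl s) Q (i * k + y)))
          = (\<Sum>t<r. \<Sum>t'<r. U t P x * cnj (U t' Q y) * (\<Sum>j\<in>{..<n} \<times> {..<a}. w t j * cnj (w t' j)))"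
      proof -
        have "(\<Sum>i<a. \<Sum>s<n. H (Inl s) P (i * k + x) * cnj (H (Inl s) Q (i * k + y)))
            = (\<Sum>i<a. \<Sum>s<n. (\<Sum>t<r. U t P x * w t (s, i)) * cnj (\<Sum>t<r. U t Q y * w t (s, i)))"
          using b by (simp add: H_def)
        also have "\<dots> = (\<Sum>s<n. \<Sum>i<a. (\<Sum>t<r. U t P x * w t (s, i)) * cnj (\<Sum>t<r. U t Q y * w t (s, i)))"
          by (rule sum.swap)
        also have "\<dots> = (\<Sum>j\<in>{..<n} \<times> {..<a}. (\<Sum>t<r. U t P x * w t j) * cnj (\<Sum>t<r. U t Q y * w t j))"
          by (simp add: sum.cartesian_product case_prod_beta)
        finally show ?thesis
          unfolding sum_mult_cnj_matrix .
      qed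
      have e': "(\<Sum>i<a. \<Sum>s<r. H (Inr s) P (i * k + x) * cnj (H (Inr s) Q (i * k + y)))
          = (\<Sum>t<r. \<Sum>t'<r. U t P x * cnj (U t' Q y) * (\<Sum>s<r. e t s * cnj (e t' s)))"
      proof -
        have "(\<Sum>i<a. \<Sum>s<r. H (Inr s) P (i * k + x) * cnj (H (Inr s) Q (i * k + y)))
            = (\<Sum>i<a. if i = 0 then (\<Sum>s<r. (\<Sum>t<r. U t P x * e t s) * cnj (\<Sum>t<r. U t Q y * e t s)) else 0)"
          using b by (intro sum.cong refl) (simp add: H_def)
        \<comment> \<open>Block 0 occurs in the sum because \<open>a \<noteq> 0\<close>.\<close>
        also have "\<dots> = (\<Sum>s<r. (\<Sum>t<r. U t P x * e t s) * cnj (\<Sum>t<r. U t Q y * e t s))"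
          using assms by simp
        finally show ?thesis
          unfolding sum_mult_cnj_matrix .
      qed
      have "choi (comp Quant h ?f) P x Q y = (\<Sum>i<a. choi h P (i * k + x) Q (i * k + y))"
        using b sth lh by (subst choi_comp_mixed_state) simp_all
      also have "\<dots> = (\<Sum>t<r. \<Sum>t'<r. U t P x * cnj (U t' Q y) *
          ((\<Sum>j\<in>{..<n} \<times> {..<a}. w t j * cnj (w t' j)) + (\<Sum>s<r. e t s * cnj (e t' s))))"
        using b by (simp add: ch mult_add_less sum.distrib w' e' distrib_left)
      \<comment> \<open>The coisometry relation \<open>w w^* + e e^* = 1\<close> reduces the sum to
        \<open>U U^*\<close>.\<close>
      also have "\<dots> = (\<Sum>t<r. \<Sum>t'<r. if t = t' then U t P x * cnj (U t' Q y) else 0)"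
        by (intro sum.cong refl) (simp add: we)
      also have "\<dots> = choi u P x Q y"
        using b by (simp add: U choi_kraus_arrow)
      finally show "choi (comp Quant h ?f) P x Q y = choi u P x Q y" .
    qed (use u' sth in \<open>auto simp: linear_arrow_arr intro!: linear_arrow_comp lh linear_arrow_tensor\<close>)
    moreover have "comp Quant (quantize M) h = v"
    proof (rule arrow_eqI)
      fix p c q d
      assume "p < qtgt v" "q < qtgt v" "c < qsrc v" "d < qsrc v"
      then have b: "p < ?Q" "q < ?Q" "c < a * k" "d < a * k"
        using v' by auto
      \<comment> \<open>Since \<open>M U = A\<close>, the map \<open>M\<close> takes
        \<open>U w\<close> to \<open>A w = V\<close> and \<open>U e\<close> to
        \<open>A e = 0\<close>.\<close>
      have MH: "(\<Sum>P<?P. M $$ (p, P) * (\<Sum>t<r. U t P x * z t)) = (\<Sum>t<r. A t (p, x) * z t)" for p x z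
      proof -
        have "(\<Sum>P<?P. M $$ (p, P) * (\<Sum>t<r. U t P x * z t))
            = (\<Sum>P<?P. \<Sum>t<r. M $$ (p, P) * U t P x * z t)"
          by (simp add: sum_distrib_left mult.assoc)
        also have "\<dots> = (\<Sum>t<r. \<Sum>P<?P. M $$ (p, P) * U t P x * z t)"
          by (rule sum.swap)
        finally show ?thesis
          by (simp add: A_def sum_distrib_right)
      qed
      have l: "(\<Sum>P<?P. M $$ (p, P) * H (Inl s) P c) = V s p c"
        if "s < n" "p < ?Q" "c < a * k" for s p c
        using that div_mod_less[OF that(3)] by (simp add: H_def MH w)
      have r: "(\<Sum>P<?P. M $$ (p, P) * H (Inr s) P c) = 0"
        if "s < r" "p < ?Q" "c < a * k" for s p c
        using that div_mod_less[OF that(3)]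
        by (cases "c div k = 0") (simp_all add: H_def MH e)
      have "choi (comp Quant (quantize M) h) p c q d = (\<Sum>z\<in>{..<n} <+> {..<r}.
          (\<Sum>P<?P. M $$ (p, P) * H z P c) * cnj (\<Sum>Q<?P. M $$ (q, Q) * H z Q d))"
        by (rule choi_comp_quantize) (use b in \<open>simp_all add: h_def linear_arrow_kraus choi_kraus_arrow\<close>)
      also have "\<dots> = choi v p c q d"
        using b by (simp add: sum.Plus l r V choi_kraus_arrow del: cnj_sum)
      finally show "choi (comp Quant (quantize M) h) p c q d = choi v p c q d" .
    qed (use v' sth in \<open>auto simp: linear_arrow_arr intro!: linear_arrow_comp lh linear_arrow_quantize\<close>)
    ultimately show ?thesis
      using h by blast
  qed
  then show ?thesis
    by (simp add: lifts_against_def)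
qed

text \<open>Tensoring \<open>quantize m\<close> with an identity gives
  \<open>quantize (kron m (1\<^sub>m b'))\<close>, to which the preceding lemma applies.\<close>

lemma oslash_mixed_state_quantize: "a \<noteq> 0 \<Longrightarrow> oslash Quant (mixed_state a) (quantize m)"
  unfolding oslash_def
  by (simp add: ident_Quant[of b' for b'] quantize_kron lifts_against_quantize[unfolded ident_Quant])

lemma quantize_if_oslash_mixed_states:
  assumes g: "g \<in> arr Quant" and lift: "\<And>a. a \<noteq> 0 \<Longrightarrow> oslash Quant (mixed_state a) g"
  shows "\<exists>m. g = quantize m"
proof -
  let ?B = "qsrc g" and ?C = "qtgt g"
  let ?\<omega> = "max_entangled ?B"
  note lin = linear_arrow_arr[OF g]
  obtain n :: nat and G where G: "g = kraus_arrow ?B ?C {..<n} G"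
    using arr_obtain_kraus[OF g] .
  have cg: "choi g p i q j = (\<Sum>s<n. G s p i * cnj (G s q j))"
    if "p < ?C" "q < ?C" "i < ?B" "j < ?B" for p i q j
    using that by (subst G) (simp add: choi_kraus_arrow)
  show ?thesis
  proof (cases "\<exists>s<n. \<exists>p<?C. \<exists>i<?B. G s p i \<noteq> 0")
    case False
    have "g = quantize (0\<^sub>m ?C ?B)"
    proof (rule arrow_eqI)
      fix p i q j
      assume "p < qtgt (quantize (0\<^sub>m ?C ?B))" "q < qtgt (quantize (0\<^sub>m ?C ?B))"
        "i < qsrc (quantize (0\<^sub>m ?C ?B))" "j < qsrc (quantize (0\<^sub>m ?C ?B))"
      then show "choi g p i q j = choi (quantize (0\<^sub>m ?C ?B)) p i q j"
        using False by (simp add: cg choi_quantize)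
    qed (simp_all add: lin linear_arrow_quantize)
    then show ?thesis ..
  next
    case True
    then obtain s0 p0 i0 where s0: "s0 < n" "p0 < ?C" "i0 < ?B" "G s0 p0 i0 \<noteq> 0"
      by blast
    \<comment> \<open>The ancilla is trivial on the left and \<open>qsrc g\<close> on the right, so
      that \<open>?g\<close> turns the maximally entangled state into the Choi matrix of
      \<open>g\<close>.\<close>
    let ?f = "tensor Quant (mixed_state n) (ident Quant 1)"
    let ?g = "tensor Quant g (ident Quant ?B)"
    define u where "u = kraus_arrow 1 (?B * ?B) {()} (\<lambda>_ x _. ?\<omega> x)"
    \<comment> \<open>Operator \<open>s\<close> reads off the basis vector \<open>e\<^sub>s\<close>
      and emits \<open>G\<^sub>s\<close> flattened to a vector.\<close>
    define v where "v = kraus_arrow n (?C * ?B) {..<n}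
      (\<lambda>s x i. if i = s then G s (x div ?B) (x mod ?B) else 0)"
    have cu: "choi u x 0 y 0 = ?\<omega> x * cnj (?\<omega> y)" if "x < ?B * ?B" "y < ?B * ?B" for x y
      using that by (simp add: u_def choi_kraus_arrow)
    have cv: "choi v x i y i = G i (x div ?B) (x mod ?B) * cnj (G i (y div ?B) (y mod ?B))"
      if "x < ?C * ?B" "y < ?C * ?B" "i < n" for x y i
    proof -
      have "choi v x i y i = (\<Sum>s<n. if s = i
          then G i (x div ?B) (x mod ?B) * cnj (G i (y div ?B) (y mod ?B)) else 0)"
        unfolding v_def using that
        by (subst choi_kraus_arrow; (intro sum.cong refl)?) simp_all
      then show ?thesis
        using that by simp
    qed
    have uv: "linear_arrow u" "linear_arrow v" "qsrc u = 1" "qtgt u = ?B * ?B" "qsrc v = n" "qtgt v = ?C * ?B"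
      by (simp_all add: u_def v_def linear_arrow_kraus)
    have "comp Quant ?g u = comp Quant v ?f"
    proof (rule arrow_eqI)
      fix x i y j
      assume "x < qtgt (comp Quant v ?f)" "y < qtgt (comp Quant v ?f)"
        "i < qsrc (comp Quant v ?f)" "j < qsrc (comp Quant v ?f)"
      then have b: "x < ?C * ?B" "y < ?C * ?B" "i = 0" "j = 0"
        using uv by auto
      have "choi (comp Quant ?g u) x 0 y 0 =
          (\<Sum>i<?B * ?B. \<Sum>j<?B * ?B. choi ?g x i y j * (?\<omega> i * cnj (?\<omega> j)))"
        using b uv by (subst choi_comp) (simp_all add: linear_arrow_tensor cu)
      also have "\<dots> = choi g (x div ?B) (x mod ?B) (y div ?B) (y mod ?B)"
        using lin b by (intro sum_max_entangled) auto
      \<comment> \<open>\<open>s * 1 + 0\<close> is the block index \<open>i * k + x\<close> of the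
        partial trace at \<open>k = 1\<close> and \<open>x = 0\<close>.\<close>
      also have "\<dots> = (\<Sum>s<n. choi v x (s * 1 + 0) y (s * 1 + 0))"
        using b by (simp add: cg cv div_mod_less)
      also have "\<dots> = choi (comp Quant v ?f) x 0 y 0"
        using b uv by (intro choi_comp_mixed_state[symmetric]) auto
      finally show "choi (comp Quant ?g u) x i y j = choi (comp Quant v ?f) x i y j"
        using b by simp
    qed (use uv in \<open>auto intro!: linear_arrow_comp linear_arrow_tensor\<close>)
    moreover have "u \<in> hom Quant 1 (?B * ?B)" "v \<in> hom Quant n (?C * ?B)"
      by (simp_all add: hom_def u_def v_def kraus_arrow_in_arr)
    moreover have "lifts_against Quant ?f ?g"
      using lift[of n] s0 by (auto simp: oslash_def)
    ultimately obtain h where h: "h \<in> hom Quant n (?B * ?B)"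
      and hf: "comp Quant h ?f = u" and gh: "comp Quant ?g h = v"
      unfolding lifts_against_def by auto
    then have h': "h \<in> arr Quant" "qsrc h = n" "qtgt h = ?B * ?B"
      by (auto simp: hom_def)
    obtain r :: nat and H where H: "h = kraus_arrow n (?B * ?B) {..<r} H"
      using arr_obtain_kraus[OF h'(1)] h' by metis
    have gram: "(\<Sum>t\<in>{()}. ?\<omega> x * cnj (?\<omega> y)) =
        (\<Sum>j\<in>{..<r} \<times> {..<n}. H (fst j) x (snd j) * cnj (H (fst j) y (snd j)))"
      if "x \<in> {..<?B * ?B}" "y \<in> {..<?B * ?B}" for x y
    proof -
      have b: "x < ?B * ?B" "y < ?B * ?B"
        using that by auto
      have "(\<Sum>t\<in>{()}. ?\<omega> x * cnj (?\<omega> y)) = choi (comp Quant h ?f) x 0 y 0"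
        by (simp only: hf cu[OF b] sum.insert finite.emptyI empty_iff sum.empty add_0_right simp_thms)
      also have "\<dots> = (\<Sum>i<n. choi h x (i * 1 + 0) y (i * 1 + 0))"
        using b h' linear_arrow_arr[OF h'(1)] by (intro choi_comp_mixed_state) auto
      also have "\<dots> = (\<Sum>i<n. \<Sum>t<r. H t x i * cnj (H t y i))"
        using b by (simp add: H choi_kraus_arrow)
      also have "\<dots> = (\<Sum>t<r. \<Sum>i<n. H t x i * cnj (H t y i))"
        by (rule sum.swap)
      also have "\<dots> = (\<Sum>j\<in>{..<r} \<times> {..<n}. H (fst j) x (snd j) * cnj (H (fst j) y (snd j)))"
        by (simp add: sum.cartesian_product case_prod_beta)
      finally show ?thesis .
    qed
    have fin: "finite {..<?B * ?B}" "finite {()}" "finite ({..<r} \<times> {..<n})"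
      by simp_all
    \<comment> \<open>The other Gram family consists of one vector, so every Kraus column of
      \<open>h\<close> is a multiple of it.\<close>
    obtain w :: "unit \<Rightarrow> nat \<times> nat \<Rightarrow> complex" where
      w: "\<And>j x. j \<in> {..<r} \<times> {..<n} \<Longrightarrow> x \<in> {..<?B * ?B} \<Longrightarrow>
        (\<Sum>t\<in>{()}. ?\<omega> x * w t j) = H (fst j) x (snd j)"
    proof (rule gram_eq_coisometry[OF fin gram])
    qed (assumption | rule that; assumption)+
    have Hw: "H t x i = ?\<omega> x * w () (t, i)" if "t < r" "i < n" "x < ?B * ?B" for t i x
      using w[of "(t, i)" x] that by simp
    \<comment> \<open>\<open>h\<close> sends the projector on the basis vector \<open>s0\<close> to
      \<gamma> times the maximally entangled state.\<close>
    define \<gamma> where "\<gamma> = (\<Sum>t<r. w () (t, s0) * cnj (w () (t, s0)))"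
    have ch: "choi h x s0 y s0 = \<gamma> * (?\<omega> x * cnj (?\<omega> y))" if "x < ?B * ?B" "y < ?B * ?B" for x y
      using that s0
      by (simp add: H choi_kraus_arrow Hw \<gamma>_def sum_distrib_left sum_distrib_right mult_ac)
    \<comment> \<open>Applying \<open>?g\<close> to that output yields \<gamma> times the Choi
      matrix of \<open>g\<close>, while \<open>gh\<close> says that it is the pure state of
      \<open>G s0\<close>.\<close>
    have proportional: "\<gamma> * choi g p i q j = G s0 p i * cnj (G s0 q j)"
      if b: "p < ?C" "q < ?C" "i < ?B" "j < ?B" for p i q j
    proof -
      note lt = mult_add_less[OF b(1,3)] mult_add_less[OF b(2,4)]
      have "G s0 p i * cnj (G s0 q j) = choi (comp Quant ?g h) (p * ?B + i) s0 (q * ?B + j) s0"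
        unfolding gh using lt b s0 by (simp add: cv)
      also have "\<dots> = (\<Sum>x<?B * ?B. \<Sum>y<?B * ?B. choi ?g (p * ?B + i) x (q * ?B + j) y *
          (\<gamma> * (?\<omega> x * cnj (?\<omega> y))))"
        using lt h' linear_arrow_arr[OF h'(1)]
        by (subst choi_comp) (simp_all add: linear_arrow_tensor ch)
      also have "\<dots> = \<gamma> * (\<Sum>x<?B * ?B. \<Sum>y<?B * ?B. choi ?g (p * ?B + i) x (q * ?B + j) y *
          (?\<omega> x * cnj (?\<omega> y)))"
        by (simp add: sum_distrib_left mult_ac)
      also have "\<dots> = \<gamma> * choi g p i q j"
        using sum_max_entangled[OF lin lt] b by simp
      finally show ?thesis ..
    qed
    have "0 \<le> \<gamma>"
      unfolding \<gamma>_def by (intro sum_nonneg mult_cnj_self_nonneg)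
    moreover have "\<gamma> \<noteq> 0"
      using proportional[of p0 p0 i0 i0] s0 by auto
    ultimately obtain c where c: "\<gamma> = of_real c" "c > 0"
      by (intro that[of "Re \<gamma>"]) (auto simp: less_eq_complex_def complex_eq_iff)
    \<comment> \<open>The proportionality factor is absorbed by its square root, since a pure map is
      quadratic in its operator.\<close>
    let ?m = "mat ?C ?B (\<lambda>(p, i). G s0 p i / of_real (sqrt c))"
    have "g = quantize ?m"
    proof (rule arrow_eqI)
      fix p i q j
      assume "p < qtgt (quantize ?m)" "q < qtgt (quantize ?m)" "i < qsrc (quantize ?m)" "j < qsrc (quantize ?m)"
      then have b: "p < ?C" "q < ?C" "i < ?B" "j < ?B"
        by auto
      have "complex_of_real (sqrt c) * of_real (sqrt c) = of_real c"
        using c unfolding of_real_mult[symmetric] by simp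
      then have "choi (quantize ?m) p i q j = G s0 p i * cnj (G s0 q j) / of_real c"
        using b by (simp add: choi_quantize)
      also have "\<dots> = choi g p i q j"
        using c by (simp add: proportional[OF b, symmetric])
      finally show "choi g p i q j = choi (quantize ?m) p i q j" ..
    qed (simp_all add: lin linear_arrow_quantize)
    then show ?thesis ..
  qed
qed

theorem lemma21:
  shows "symmetric_monoidal_subcategory Quant pure_morphisms
    \<and> pure_morphisms = quantize ` arr FHilb"
proof
  have arr: "arr FHilb = UNIV"
    by (simp add: FHilb_def)
  show pure: "pure_morphisms = quantize ` arr FHilb"
  proof (intro equalityI subsetI)
    fix g assume "g \<in> pure_morphisms"
    then have g: "g \<in> arr Quant" and "\<And>a. a \<noteq> 0 \<Longrightarrow> oslash Quant (mixed_state a) g"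
      unfolding pure_morphisms_def right_oslash_def mixed_states_def by blast+
    from quantize_if_oslash_mixed_states[OF this] show "g \<in> quantize ` arr FHilb"
      unfolding arr by blast
  next
    fix g assume "g \<in> quantize ` arr FHilb"
    then obtain m where g: "g = quantize m"
      by blast
    show "g \<in> pure_morphisms"
      unfolding pure_morphisms_def right_oslash_def mixed_states_def g
      using quantize_in_arr oslash_mixed_state_quantize by auto
  qed
  have "dim_row (swap_mat a b) = b * a" "dim_col (swap_mat a b) = a * b" for a b
    by (simp_all add: swap_mat_def)
  then have "braid Quant a b = quantize (swap_mat a b)" for a b
    by (simp add: Quant_def quantize_def)
  \<comment> \<open>The functor preserves composition and tensor products, and identities and
    braidings are images of \<open>1\<^sub>m a\<close> and \<open>swap_mat a b\<close>; so its image
    is closed under all the structure.\<close>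
  then show "symmetric_monoidal_subcategory Quant pure_morphisms"
    unfolding symmetric_monoidal_subcategory_def pure arr
    by (auto simp: quantize_in_arr ident_Quant quantize_mult quantize_kron)
qed

end
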